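(* Let $n$ and $m$ be integers such that $m$ is even and $n+2\leq m\leq 2n-2$. Then $$R(K_{1,n},W_m)=\begin{cases}2n+m/2-1, & \text{if both } n \text{ and } m/2 \text{ are even};\\ 2n+m/2, & \text{otherwise.}\end{cases}$$
   Context: All graphs are finite and simple. For graphs $G_1,G_2$, the Ramsey number $R(G_1,G_2)$ is the least integer $r$ such that for every graph $G$ on $r$ vertices, either $G$ contains a subgraph isomorphic to $G_1$ or the complement $\overline{G}$ contains a subgraph isomorphic to $G_2$. $K_{1,n}$ is the star with $n$ leaves. For $m\geq 3$, the wheel $W_m$ is the graph on $m+1$ vertices obtained from a cycle $C_m$ by adding one new vertex adjacent to all vertices of the cycle. *)

theory Defs
  imports "HOL-Library.Ramsey"
begin

record 'a graph =
  verts :: "'a set"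
  edges :: "'a set set"

text \<open>Edges are two-element sets of vertices, so loops and multiple edges are excluded.\<close>

definition simple_graph :: "'a graph \<Rightarrow> bool" where
  "simple_graph G \<longleftrightarrow> finite (verts G) \<and> edges G \<subseteq> nsets (verts G) 2"

definition complement :: "'a graph \<Rightarrow> 'a graph" where
  "complement G = \<lparr>verts = verts G, edges = nsets (verts G) 2 - edges G\<rparr>"

definition subgraph :: "'a graph \<Rightarrow> 'a graph \<Rightarrow> bool" where
  "subgraph H G \<longleftrightarrow> simple_graph H \<and> verts H \<subseteq> verts G \<and> edges H \<subseteq> edges G"

definition isomorphic :: "'a graph \<Rightarrow> 'b graph \<Rightarrow> bool" where
  "isomorphic G H \<longleftrightarrow>
    (\<exists>f. bij_betw f (verts G) (verts H) \<and> edges H = (\<lambda>e. f ` e) ` edges G)"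

definition contains_copy :: "'a graph \<Rightarrow> 'b graph \<Rightarrow> bool" where
  "contains_copy G H \<longleftrightarrow> (\<exists>S. subgraph S G \<and> isomorphic S H)"

text \<open>Host graphs range over graphs with vertices in \<^typ>\<open>nat\<close>; every finite graph is isomorphic
  to one of these.\<close>

definition ramsey_number :: "'a graph \<Rightarrow> 'b graph \<Rightarrow> nat" where
  "ramsey_number G1 G2 =
    (LEAST r. \<forall>G :: nat graph. simple_graph G \<and> card (verts G) = r \<longrightarrow>
       contains_copy G G1 \<or> contains_copy (complement G) G2)"

definition star :: "nat \<Rightarrow> nat graph" where
  "star n = \<lparr>verts = {0..n}, edges = {{0, i} | i. i \<in> {1..n}}\<rparr>"

text \<open>The cycle is only meaningful for \<open>m \<ge> 3\<close>, and so is the wheel built from it.\<close>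

definition cycle :: "nat \<Rightarrow> nat graph" where
  "cycle m = \<lparr>verts = {0..<m}, edges = {{i, Suc i mod m} | i. i < m}\<rparr>"

definition wheel :: "nat \<Rightarrow> nat graph" where
  "wheel m = \<lparr>verts = insert m (verts (cycle m)),
              edges = edges (cycle m) \<union> {{m, v} | v. v \<in> verts (cycle m)}\<rparr>"

lemma simple_graph_star: "simple_graph (star n)"
  by (auto simp: simple_graph_def star_def nsets_def card_insert_if)

lemma simple_graph_cycle:
  assumes "3 \<le> m"
  shows "simple_graph (cycle m)"
proof -
  have "Suc i mod m < m" "i \<noteq> Suc i mod m" if "i < m" for i
    using assms that by (auto simp: mod_Suc split: if_splits)
  then show ?thesis
    by (auto simp: simple_graph_def cycle_def nsets_def card_insert_if)
qed

lemma simple_graph_wheel: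
  assumes "3 \<le> m"
  shows "simple_graph (wheel m)"
  using simple_graph_cycle[OF assms]
  by (auto simp: simple_graph_def wheel_def cycle_def nsets_def card_insert_if)

lemma simple_graph_complement: "simple_graph G \<Longrightarrow> simple_graph (complement G)"
  by (auto simp: simple_graph_def complement_def)

end

theory Submission
  imports Defs
begin

text \<open>Let \<open>m = 2k\<close> and let \<open>H\<close> be the complement of a graph without \<open>K\<^bsub>1,n\<^esub>\<close>, so that every vertex of \<open>H\<close>
  has at most \<open>n - 1\<close> non-neighbours. Choose a vertex \<open>v\<close> with a set \<open>U\<close> of \<open>n + k\<close> neighbours and let
  \<open>W\<close> be the rest; a cycle \<open>C\<^bsub>2k\<^esub>\<close> inside \<open>U\<close> is wanted. Let \<open>x \<in> U\<close> have the most neighbours in \<open>W\<close>. Unless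
  the bipartite graph between \<open>N(x) \<inter> U\<close> and \<open>N(x) \<inter> W\<close> contains \<open>C\<^bsub>2k\<^esub>\<close>, which makes \<open>x\<close> the hub of a
  wheel, some neighbour \<open>y \<in> U\<close> of \<open>x\<close> has few neighbours in \<open>W\<close>, hence very many in \<open>U\<close>: fewer
  vertices of \<open>U\<close> are non-adjacent to \<open>y\<close> than the minimum degree of \<open>H[U]\<close>. If \<open>U - y\<close> is connected,
  it contains a path on \<open>2k - 1\<close> vertices that \<open>y\<close> closes to a cycle. Otherwise
  \<open>U - y\<close> splits into two parts, and a vertex of one of the parts is the hub of a wheel; here the
  parity condition enters.

  For the lower bound, \<open>H\<close> is an independent set of size \<open>n\<close> joined to a \<open>(k - 1)\<close>-regular graph with
  components too small to contain \<open>C\<^bsub>2k\<^esub>\<close>.\<close>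

section \<open>Paths and cycles\<close>

text \<open>The two cases of the formula differ because a \<open>(k - 1)\<close>-regular graph on
  \<open>n - 1\<close> vertices exists only if \<open>(k - 1) * (n - 1)\<close> is even. If
  \<open>n\<close> and \<open>k\<close> are both even, the regular part of the host has to shrink to
  \<open>n - 2\<close> vertices, and the upper bound must be reached with one vertex less. Several
  estimates then lose a unit, which parity restores: a graph that is regular of odd degree has even
  order, \<open>n = k + 1\<close> is impossible, and \<open>2 * card X1 + 1\<close> differs from
  \<open>n + k\<close>. The obstacle inside \<open>U\<close> is that the guaranteed minimum degree
  can be little more than a third of the order, too small for general degree conditions to yield a
  cycle of prescribed length. The vertex \<open>y\<close> compensates: with \<open>N\<close> its
  neighbourhood, non-neighbours are deleted until at most \<open>k - 1\<close> remain. On a suitable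
  extremal path each long chord at an end forces vertices outside \<open>N\<close>, and an end has
  at least as many neighbours as there are such vertices in all, or one less. The count leaves a
  single borderline case, a path on \<open>2 * k\<close> vertices, which takes a separate
  argument.\<close>

definition pth :: "('a \<Rightarrow> 'a \<Rightarrow> bool) \<Rightarrow> 'a set \<Rightarrow> 'a list \<Rightarrow> bool" where
  "pth E A xs \<longleftrightarrow> distinct xs \<and> set xs \<subseteq> A \<and> successively E xs"

definition cyc :: "('a \<Rightarrow> 'a \<Rightarrow> bool) \<Rightarrow> 'a set \<Rightarrow> 'a list \<Rightarrow> bool" where
  "cyc E A cs \<longleftrightarrow> 3 \<le> length cs \<and> pth E A cs \<and> E (last cs) (hd cs)"

definition nbs :: "('a \<Rightarrow> 'a \<Rightarrow> bool) \<Rightarrow> 'a set \<Rightarrow> 'a \<Rightarrow> 'a set" where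
  "nbs E A x = {y \<in> A. E x y}"

lemma in_nbs [simp]: "y \<in> nbs E A x \<longleftrightarrow> y \<in> A \<and> E x y"
  by (simp add: nbs_def)

lemma finite_nbs [simp]: "finite A \<Longrightarrow> finite (nbs E A x)"
  by (simp add: nbs_def)

lemma nbs_subset: "nbs E A x \<subseteq> A"
  by auto

lemma nbs_mono: "A \<subseteq> B \<Longrightarrow> nbs E A x \<subseteq> nbs E B x"
  by auto

lemma last_take_Suc: "i < length xs \<Longrightarrow> last (take (Suc i) xs) = xs ! i"
  by (simp add: take_Suc_conv_app_nth)

lemma hd_nth_0: "0 < length xs \<Longrightarrow> hd xs = xs ! 0"
  by (simp add: hd_conv_nth)

lemma pth_Nil [simp]: "pth E A []"
  by (simp add: pth_def)

lemma pth_single [simp]: "pth E A [x] \<longleftrightarrow> x \<in> A"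
  by (simp add: pth_def)

lemma pth_Cons: "pth E A (x # xs) \<longleftrightarrow>
    x \<in> A \<and> x \<notin> set xs \<and> pth E A xs \<and> (xs = [] \<or> E x (hd xs))"
  by (cases xs) (auto simp: pth_def)

lemma pth_append: "pth E A (xs @ ys) \<longleftrightarrow> pth E A xs \<and> pth E A ys \<and> set xs \<inter> set ys = {} \<and>
    (xs = [] \<or> ys = [] \<or> E (last xs) (hd ys))"
  by (auto simp: pth_def successively_append_iff)

lemma pth_mono: "pth E A xs \<Longrightarrow> A \<subseteq> B \<Longrightarrow> pth E B xs"
  by (auto simp: pth_def)

lemma cyc_mono: "cyc E A xs \<Longrightarrow> A \<subseteq> B \<Longrightarrow> cyc E B xs"
  by (auto simp: cyc_def intro: pth_mono)

lemma pth_take: "pth E A xs \<Longrightarrow> pth E A (take i xs)"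
  by (metis append_take_drop_id pth_append)

lemma pth_drop: "pth E A xs \<Longrightarrow> pth E A (drop i xs)"
  by (metis append_take_drop_id pth_append)

lemma pth_distinct: "pth E A xs \<Longrightarrow> distinct xs"
  by (simp add: pth_def)

lemma pth_subset: "pth E A xs \<Longrightarrow> set xs \<subseteq> A"
  by (simp add: pth_def)

lemma pth_length_le: "pth E A xs \<Longrightarrow> finite A \<Longrightarrow> length xs \<le> card A"
  by (metis card_mono distinct_card pth_def)

lemma cyc_rotate: "cyc E A (xs @ ys) \<Longrightarrow> cyc E A (ys @ xs)"
  by (cases "xs = []"; cases "ys = []") (auto simp: cyc_def pth_append)

definition segment :: "'a list \<Rightarrow> nat \<Rightarrow> nat \<Rightarrow> 'a list" where
  "segment xs i j = take (j - i + 1) (drop i xs)"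

lemma segment:
  assumes "pth E A xs" "i \<le> j" "j < length xs"
  shows "pth E A (segment xs i j)" "length (segment xs i j) = j - i + 1"
    "segment xs i j \<noteq> []" "hd (segment xs i j) = xs ! i" "last (segment xs i j) = xs ! j"
proof -
  show "pth E A (segment xs i j)"
    unfolding segment_def by (intro pth_take pth_drop assms)
  show l: "length (segment xs i j) = j - i + 1" using assms by (simp add: segment_def)
  then show ne: "segment xs i j \<noteq> []" by auto
  show "hd (segment xs i j) = xs ! i"
    using ne assms by (simp add: hd_conv_nth segment_def)
  show "last (segment xs i j) = xs ! j"
    using ne l assms by (simp add: last_conv_nth segment_def)
qed

locale sgraph =
  fixes E :: "'a \<Rightarrow> 'a \<Rightarrow> bool"
  assumes sym: "E x y \<Longrightarrow> E y x" and irr: "\<not> E x x"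
begin

lemma sym_iff: "E x y \<longleftrightarrow> E y x"
  using sym by blast

lemma pth_rev [simp]: "pth E A (rev xs) \<longleftrightarrow> pth E A xs"
proof -
  have "(\<lambda>x y. E y x) = E" using sym_iff by (intro ext) blast
  then show ?thesis by (simp add: pth_def del: successively_rev) (simp only: successively_rev)
qed

text \<open>This is Posa's rotation: a chord from \<open>xs ! 0\<close> to \<open>xs ! b\<close>
  yields a path on the same vertices that starts at \<open>xs ! (b - 1)\<close> and keeps its last
  vertex.\<close>

definition flip :: "'a list \<Rightarrow> nat \<Rightarrow> 'a list" where
  "flip xs b = rev (take b xs) @ drop b xs"

lemma flip:
  assumes "pth E A xs" "1 \<le> b" "b < length xs" "E (xs ! 0) (xs ! b)"
  shows "pth E A (flip xs b)" "length (flip xs b) = length xs" "set (flip xs b) = set xs"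
    "\<And>i. i < b \<Longrightarrow> flip xs b ! i = xs ! (b - 1 - i)"
    "\<And>i. b \<le> i \<Longrightarrow> i < length xs \<Longrightarrow> flip xs b ! i = xs ! i"
    "last (flip xs b) = last xs" "hd (flip xs b) = xs ! (b - 1)"
proof -
  have t: "pth E A (take b xs)" "pth E A (drop b xs)" using assms pth_take pth_drop by blast+
  have "set (take b xs) \<inter> set (drop b xs) = {}"
    using pth_distinct[OF assms(1)] by (metis append_take_drop_id distinct_append)
  moreover have "last (rev (take b xs)) = xs ! 0"
    using assms by (simp add: last_rev hd_nth_0)
  moreover have "hd (drop b xs) = xs ! b" using assms by (simp add: hd_drop_conv_nth)
  ultimately show "pth E A (flip xs b)"
    using t assms unfolding flip_def by (auto simp: pth_append)
  show "length (flip xs b) = length xs" using assms by (simp add: flip_def)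
  show "set (flip xs b) = set xs"
    by (simp add: flip_def) (metis append_take_drop_id set_append)
  show 1: "flip xs b ! i = xs ! (b - 1 - i)" if "i < b" for i
    using that assms by (simp add: flip_def nth_append rev_nth)
  show "flip xs b ! i = xs ! i" if "b \<le> i" "i < length xs" for i
    using that assms by (simp add: flip_def nth_append)
  show "last (flip xs b) = last xs" using assms by (simp add: flip_def)
  show "hd (flip xs b) = xs ! (b - 1)"
    using 1[of 0] assms by (subst hd_conv_nth) (auto simp: flip_def)
qed

lemma chord_cyc:
  assumes "pth E A xs" "2 \<le> b" "b < length xs" "E (xs ! 0) (xs ! b)"
  shows "cyc E A (take (b + 1) xs)"
proof -
  have "last (take (b + 1) xs) = xs ! b" "hd (take (b+1) xs) = xs ! 0"
    using assms by (auto simp: last_take_Suc hd_nth_0)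
  then show ?thesis using assms sym by (auto simp: cyc_def intro: pth_take)
qed

text \<open>The cycle follows the path up to \<open>xs ! b'\<close>, jumps to the last vertex, walks
  back to \<open>xs ! b\<close> and closes by the other chord; only the vertices strictly between
  \<open>b'\<close> and \<open>b\<close> are lost.\<close>

lemma two_chords_cyc:
  assumes "pth E A xs" "b' < b" "b < length xs" "E (xs ! 0) (xs ! b)"
    "E (xs ! (length xs - 1)) (xs ! b')" "3 \<le> b' + 1 + (length xs - b)"
  shows "cyc E A (take (b' + 1) xs @ rev (drop b xs))"
proof -
  have "set (take (b' + 1) xs) \<subseteq> set (take b xs)"
    using assms by (simp add: set_take_subset_set_take)
  moreover have "set (take b xs) \<inter> set (drop b xs) = {}"
    using pth_distinct[OF assms(1)] by (metis append_take_drop_id distinct_append)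
  ultimately have d: "set (take (b' + 1) xs) \<inter> set (drop b xs) = {}" by auto
  have "last (take (b' + 1) xs) = xs ! b'" "hd (take (b' + 1) xs) = xs ! 0"
    "hd (rev (drop b xs)) = xs ! (length xs - 1)" "last (rev (drop b xs)) = xs ! b"
    using assms by (auto simp: last_conv_nth last_take_Suc hd_nth_0 hd_rev last_rev hd_drop_conv_nth)
  moreover from this have "hd (take (b' + 1) xs @ rev (drop b xs)) = xs ! 0"
    using assms by (cases xs) auto
  ultimately show ?thesis
    using assms d sym unfolding cyc_def by (auto simp: pth_append pth_take pth_drop)
qed

end

section \<open>Cycles in bipartite graphs\<close>

lemma cyc_rotate_n: "cyc E A cs \<Longrightarrow> cyc E A (rotate n cs)"
  by (simp add: rotate_drop_take) (metis append_take_drop_id cyc_rotate)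

lemma rotate_ends:
  assumes "i < length cs"
  shows "hd (rotate (i + 1) cs) = cs ! ((i + 1) mod length cs)" "last (rotate (i + 1) cs) = cs ! i"
proof -
  have "cs \<noteq> []" using assms by auto
  then show "hd (rotate (i + 1) cs) = cs ! ((i + 1) mod length cs)"
    by (rule hd_rotate_conv_nth)
  have "i + 1 + (length cs - 1) = i + length cs" using assms by simp
  then have "(i + 1 + (length cs - 1)) mod length cs = i" using assms by simp
  then show "last (rotate (i + 1) cs) = cs ! i"
    using assms \<open>cs \<noteq> []\<close> by (subst last_conv_nth) (auto simp: nth_rotate simp del: rotate_Suc)
qed

lemma cyc_nth_Suc:
  assumes "cyc E A cs" "i < length cs"
  shows "E (cs ! i) (cs ! ((i + 1) mod length cs))"
proof -
  have "cyc E A (rotate (i + 1) cs)" by (rule cyc_rotate_n[OF assms(1)])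
  then have "E (last (rotate (i + 1) cs)) (hd (rotate (i + 1) cs))" unfolding cyc_def by blast
  then show ?thesis using rotate_ends[OF assms(2)] by simp
qed

lemma cyc_rel_mono: "cyc E A cs \<Longrightarrow> (\<And>x y. E x y \<Longrightarrow> E' x y) \<Longrightarrow> cyc E' A cs"
  unfolding cyc_def pth_def by (auto intro: successively_mono)

context sgraph begin

text \<open>Jackson's theorem for bipartite graphs, in the balanced case. In a longest alternating cycle,
  the neighbours of a missing vertex \<open>x\<^sub>0\<close> have successors whose neighbourhoods
  outside the cycle are disjoint from each other and from that of \<open>x\<^sub>0\<close>.\<close>

lemma bipartite_cycle:
  assumes fin: "finite X" "finite Y" and disj: "X \<inter> Y = {}"
    and k: "card X = k" "2 \<le> k" "card Y \<le> 2 * k - 2"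
    and deg: "\<And>x. x \<in> X \<Longrightarrow> k \<le> card (nbs E Y x)"
  shows "\<exists>cs. cyc E (X \<union> Y) cs \<and> length cs = 2 * k"
proof -
  \<comment> \<open>With the edges inside \<open>X\<close> and inside \<open>Y\<close> dropped,
    cycles alternate, so the successor of a vertex of \<open>Y\<close> is in
    \<open>X\<close>.\<close>
  define B where "B x y \<longleftrightarrow> E x y \<and> (x \<in> X \<and> y \<in> Y \<or> x \<in> Y \<and> y \<in> X)" for x y
  interpret B: sgraph B
    by unfold_locales (auto simp: B_def irr intro: sym)
  define Good where "Good j \<longleftrightarrow> (\<exists>cs. cyc B (X \<union> Y) cs \<and> card (set cs \<inter> X) = j \<and> card (set cs \<inter> Y) = j)" for j
  have step: "Good (Suc j)" if j: "2 \<le> j" "j < k" and G: "Good j" for j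
  proof (rule ccontr)
    assume notG: "\<not> Good (Suc j)"
    from G obtain cs where cs: "cyc B (X \<union> Y) cs" and cX: "card (set cs \<inter> X) = j"
      and cY: "card (set cs \<inter> Y) = j" unfolding Good_def by blast
    define L where "L = length cs"
    have dcs: "distinct cs" "set cs \<subseteq> X \<union> Y" "3 \<le> L"
      using cs by (auto simp: cyc_def pth_def L_def)
    have "set cs \<inter> X \<noteq> X" using cX k j by auto
    then obtain x0 where x0: "x0 \<in> X" "x0 \<notin> set cs" by auto
    have "set cs = (set cs \<inter> X) \<union> (set cs \<inter> Y)" using dcs by auto
    then have "card (set cs) = j + j"
      using card_Un_disjoint[of "set cs \<inter> X" "set cs \<inter> Y"] cX cY fin disj by auto
    then have L2: "L = 2 * j" using dcs distinct_card[of cs] L_def by simp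
    define Off where "Off = Y - set cs"
    have finOff: "finite Off" using fin by (simp add: Off_def)
    have cOff: "card Off + j = card Y"
      unfolding Off_def using cY fin
      by (metis Int_commute add.commute card_Diff_subset_Int card_mono finite_Int inf_le1 le_add_diff_inverse)
    have extend: "Good (Suc j)"
      if "cyc B (X \<union> Y) ds" "set ds = set cs \<union> {x0, y}" "y \<in> Off" for ds y
    proof -
      have "set ds \<inter> X = insert x0 (set cs \<inter> X)" "set ds \<inter> Y = insert y (set cs \<inter> Y)"
        using that x0 disj unfolding Off_def by auto
      then have "card (set ds \<inter> X) = Suc j" "card (set ds \<inter> Y) = Suc j"
        using x0 that cX cY unfolding Off_def by auto
      then show ?thesis using that unfolding Good_def by blast
    qed
    define I where "I = {i. i < L \<and> B x0 (cs ! i)}"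
    define s where "s i = cs ! ((i + 1) mod L)" for i
    have sB: "B (cs ! i) (s i)" if "i < L" for i
      using cyc_nth_Suc[OF cs] that unfolding L_def s_def by blast
    have sX: "s i \<in> X \<inter> set cs" if "i \<in> I" for i
    proof -
      have i: "i < L" "cs ! i \<in> Y" using that x0 disj by (auto simp: I_def B_def)
      then show ?thesis using sB[of i] disj dcs by (auto simp: B_def s_def L_def intro!: nth_mem mod_less_divisor)
    qed
    have t1: "nbs E Off x0 \<inter> nbs E Off (s i) = {}" if i: "i \<in> I" for i
    proof (rule ccontr)
      assume "\<not> ?thesis"
      then obtain y where y: "y \<in> Off" "E x0 y" "E (s i) y" by auto
      define cr where "cr = rotate (i + 1) cs"
      have iL: "i < length cs" "B x0 (cs ! i)" using i by (auto simp: I_def L_def)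
      have cr: "cyc B (X \<union> Y) cr" "hd cr = s i" "last cr = cs ! i" "set cr = set cs"
        unfolding cr_def using cyc_rotate_n[OF cs, of "i + 1"] rotate_ends[OF iL(1)]
        by (simp_all add: s_def L_def del: rotate_Suc)
      have "cr \<noteq> []" using cr by (auto simp: cyc_def)
      moreover have "B x0 y" "B (s i) y" using y x0 sX[OF i] by (auto simp: B_def Off_def)
      moreover have "x0 \<noteq> y" "y \<notin> set cr" "y \<in> Y" using y x0 disj cr by (auto simp: Off_def)
      \<comment> \<open>The detour over \<open>x0\<close> and \<open>y\<close> is inserted between
        \<open>cs ! i\<close> and its successor \<open>s i\<close>.\<close>
      ultimately have "cyc B (X \<union> Y) (cr @ [x0, y])"
        using cr x0 iL B.sym unfolding cyc_def by (auto simp: pth_append pth_Cons)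
      from extend[OF this _ y(1)] notG show False using cr by auto
    qed
    have t2: "nbs E Off (s i) \<inter> nbs E Off (s l) = {}" if i: "i \<in> I" and l: "l \<in> I" and ne: "i \<noteq> l" for i l
    proof (rule ccontr)
      assume "\<not> ?thesis"
      then obtain y where y: "y \<in> Off" "E (s l) y" "E (s i) y" by auto
      define cr where "cr = rotate (i + 1) cs"
      have iL: "i < length cs" "B x0 (cs ! i)" "l < length cs" "B x0 (cs ! l)"
        using i l by (auto simp: I_def L_def)
      have cr: "cyc B (X \<union> Y) cr" "hd cr = s i" "last cr = cs ! i" "set cr = set cs" "length cr = L"
        unfolding cr_def using cyc_rotate_n[OF cs, of "i + 1"] rotate_ends[OF iL(1)]
        by (simp_all add: s_def L_def del: rotate_Suc)
      have "cs ! l \<in> set cr" using iL cr by auto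
      then obtain q where q: "q < L" "cr ! q = cs ! l" using cr by (metis in_set_conv_nth)
      have crq: "cr ! q' = cs ! ((i + 1 + q') mod L)" if "q' < L" for q'
        using that unfolding cr_def L_def by (simp add: nth_rotate del: rotate_Suc)
      have lq: "l = (i + 1 + q) mod L"
        using crq[OF q(1)] q iL dcs by (metis L_def mod_less_divisor nth_eq_iff_index_eq less_nat_zero_code not_gr_zero)
      have "q + 1 \<noteq> L"
      proof
        assume "q + 1 = L"
        then have "i + 1 + q = i + L" by simp
        then have "l = (i + L) mod L" using lq by metis
        then have "l = i" using iL L_def by simp
        then show False using ne by simp
      qed
      then have q1: "q + 1 < L" using q by simp
      have crq1: "cr ! (q + 1) = s l"
        using crq[OF q1] unfolding s_def lq by (simp add: mod_Suc_eq add.assoc)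
      define P Q where "P = take (q + 1) cr" and "Q = drop (q + 1) cr"
      have PQ: "cr = P @ Q" "P \<noteq> []" "Q \<noteq> []" using q1 cr by (auto simp: P_def Q_def)
      have ends: "hd P = s i" "last P = cs ! l" "hd Q = s l" "last Q = cs ! i"
        using PQ cr q crq1 q1 by (auto simp: P_def Q_def last_take_Suc hd_drop_conv_nth simp flip: hd_append2)
      have pp: "pth B (X \<union> Y) P" "pth B (X \<union> Y) Q" "set P \<inter> set Q = {}" "set P \<union> set Q = set cs"
        using cr PQ by (auto simp: cyc_def pth_append)
      have BB: "B y (s i)" "B (s l) y" using y x0 sX[OF i] sX[OF l] by (auto simp: B_def Off_def intro: sym)
      have "x0 \<noteq> y" "y \<notin> set P" "y \<notin> set Q" "y \<in> Y" "x0 \<notin> set P" "x0 \<notin> set Q"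
        using y x0 disj pp by (auto simp: Off_def)
      \<comment> \<open>The tour runs from \<open>s i\<close> to \<open>cs ! l\<close>, over
        \<open>x0\<close> to \<open>cs ! i\<close>, backwards to \<open>s l\<close> and over
        \<open>y\<close> home.\<close>
      then have "cyc B (X \<union> Y) (P @ [x0] @ rev Q @ [y])"
        using pp PQ ends x0 iL BB B.sym unfolding cyc_def
        by (auto simp: pth_append pth_Cons hd_append last_rev hd_rev Suc_le_eq length_greater_0_conv)
      from extend[OF this _ y(1)] notG show False using pp by auto
    qed
    have degoff: "k \<le> card (nbs E Off x) + j" if "x \<in> X" for x
    proof -
      have "nbs E Y x \<subseteq> nbs E Off x \<union> (set cs \<inter> Y)" by (auto simp: Off_def)
      then have "card (nbs E Y x) \<le> card (nbs E Off x \<union> (set cs \<inter> Y))"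
        using fin finOff by (intro card_mono) auto
      also have "\<dots> \<le> card (nbs E Off x) + j" using card_Un_le cY by metis
      finally show ?thesis using deg[OF that] by linarith
    qed
    have finI: "finite I" by (simp add: I_def)
    show False
    proof (cases "I = {}")
      case False
      have "nbs E Y x0 \<subseteq> nbs E Off x0 \<union> (\<lambda>i. cs ! i) ` I"
        using x0 unfolding I_def L_def by (fastforce simp: Off_def B_def in_set_conv_nth)
      then have "card (nbs E Y x0) \<le> card (nbs E Off x0 \<union> (\<lambda>i. cs ! i) ` I)"
        using finI finOff by (intro card_mono) auto
      also have "\<dots> \<le> card (nbs E Off x0) + card I"
        using card_Un_le card_image_le[OF finI] by (meson add_left_mono le_trans)
      finally have a0: "k \<le> card (nbs E Off x0) + card I" using deg[OF x0(1)] by linarith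
      have "card (\<Union>i\<in>I. nbs E Off (s i)) = (\<Sum>i\<in>I. card (nbs E Off (s i)))"
        using t2 finI finOff by (intro card_UN_disjoint) auto
      also have "\<dots> \<ge> card I * (k - j)"
        using degoff sX by (intro sum_bounded_below[of I "k - j" "\<lambda>i. card (nbs E Off (s i))", simplified])
          (metis IntD1 add.commute le_diff_conv)
      finally have u1: "card I * (k - j) \<le> card (\<Union>i\<in>I. nbs E Off (s i))" .
      have "nbs E Off x0 \<inter> (\<Union>i\<in>I. nbs E Off (s i)) = {}" using t1 by blast
      then have "card (nbs E Off x0) + card (\<Union>i\<in>I. nbs E Off (s i))
          = card (nbs E Off x0 \<union> (\<Union>i\<in>I. nbs E Off (s i)))"
        using finI finOff by (intro card_Un_disjoint[symmetric]) auto
      also have "\<dots> \<le> card Off" using finOff by (intro card_mono) auto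
      finally have "card (nbs E Off x0) + card I * (k - j) \<le> card Off" using u1 by linarith
      \<comment> \<open>As \<open>I\<close> is nonempty, the disjoint neighbourhoods fill at least
        \<open>k - card I + card I * (k - j) \<ge> 2 * k - j - 1\<close> vertices of
        \<open>Off\<close>, one more than it can have.\<close>
      moreover obtain e where e: "k = j + Suc e" using j by (metis less_imp_Suc_add add_Suc_right)
      moreover have "card I * (k - j) = card I + card I * e" using e by simp
      moreover have "e \<le> card I * e" using False finI by (simp add: card_gt_0_iff Suc_le_eq)
      ultimately show False using a0 cOff k(3) by linarith
    next
      case True
      \<comment> \<open>No neighbour of \<open>x0\<close> is on the cycle. Then every vertex of
        \<open>X\<close> shares two vertices of \<open>Off\<close> with \<open>x0\<close>, and for
        consecutive \<open>a\<close>, \<open>b\<close>, \<open>c\<close> with \<open>a\<close> in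
        \<open>X\<close> the vertex \<open>b\<close> can give way to \<open>y1\<close>,
        \<open>x0\<close>, \<open>y2\<close>.\<close>
      have "nbs E Y x0 \<subseteq> nbs E Off x0"
        using True x0 unfolding I_def L_def by (fastforce simp: Off_def B_def in_set_conv_nth)
      then have c0: "k \<le> card (nbs E Off x0)"
        using deg[OF x0(1)] card_mono[of "nbs E Off x0" "nbs E Y x0"] finOff by simp
      have common: "2 \<le> card (nbs E Off x0 \<inter> nbs E Off x)" if "x \<in> X" for x
      proof -
        have "card (nbs E Off x0) + card (nbs E Off x)
            = card (nbs E Off x0 \<union> nbs E Off x) + card (nbs E Off x0 \<inter> nbs E Off x)"
          using finOff by (intro card_Un_Int) auto
        moreover have "card (nbs E Off x0 \<union> nbs E Off x) \<le> card Off"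
          using finOff by (intro card_mono) auto
        ultimately show ?thesis using c0 degoff[OF that] cOff k j by linarith
      qed
      obtain x where "x \<in> set cs \<inter> X" using cX j by (metis card.empty ex_in_conv not_numeral_le_zero)
      then obtain i where i: "i < L" "cs ! i \<in> X" by (metis IntD1 IntD2 L_def in_set_conv_nth)
      define cr where "cr = rotate i cs"
      have cr: "cyc B (X \<union> Y) cr" "set cr = set cs" "length cr = L"
        unfolding cr_def using cyc_rotate_n[OF cs] by (simp_all add: L_def)
      have hdX: "hd cr \<in> X" using i unfolding cr_def
        by (subst hd_rotate_conv_nth) (auto simp: L_def)
      have "4 \<le> length cr" using cr(3) L2 j by simp
      then obtain a b c rest where crs: "cr = a # b # c # rest" "rest \<noteq> []"
        by (cases cr; cases "tl cr"; cases "tl (tl cr)"; cases "tl (tl (tl cr))") auto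
      have ab: "a \<in> X" "B a b" "B b c" "a \<noteq> c" using cr hdX crs by (auto simp: cyc_def pth_Cons)
      then have bc: "b \<in> Y" "c \<in> X" using disj by (auto simp: B_def)
      from common[OF ab(1)] obtain y1 where y1: "y1 \<in> Off" "E x0 y1" "E a y1"
        by (metis IntD1 IntD2 card.empty ex_in_conv in_nbs not_numeral_le_zero)
      have "\<not> nbs E Off x0 \<inter> nbs E Off c \<subseteq> {y1}"
        using common[OF bc(2)] card_mono[of "{y1}" "nbs E Off x0 \<inter> nbs E Off c"] by auto
      then obtain y2 where y2: "y2 \<in> Off" "E x0 y2" "E c y2" "y2 \<noteq> y1"
        unfolding subset_iff by (metis Int_iff in_nbs singletonI)
      define ds where "ds = a # y1 # x0 # y2 # c # rest"
      have "cyc B (X \<union> Y) ds"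
        using cr crs ab bc y1 y2 x0 disj unfolding ds_def cyc_def
        by (auto simp: pth_Cons Off_def B_def intro: sym)
      moreover have "set ds \<inter> X = insert x0 (set cs \<inter> X)"
        "set ds \<inter> Y = insert y1 (insert y2 (set cs \<inter> Y - {b}))"
        using cr(1) unfolding cr(2)[symmetric] crs ds_def using y1 y2 x0 ab bc disj
        by (auto simp: Off_def cyc_def pth_Cons)
      moreover have "b \<in> set cs" using cr(2) crs by auto
      then have "card (insert y1 (insert y2 (set cs \<inter> Y - {b}))) = Suc j"
        using y1 y2 bc cY j by (auto simp: Off_def)
      ultimately have "Good (Suc j)" unfolding Good_def using x0 cX by (intro exI[of _ ds]) auto
      then show False using notG by simp
    qed
  qed
  have base: "Good 2"
  proof -
    obtain x1 x2 where x: "x1 \<in> X" "x2 \<in> X" "x1 \<noteq> x2"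
      using k by (metis card_2_iff' card_le_Suc0_iff_eq fin(1) not_less_eq_eq numeral_2_eq_2)
    have "card (nbs E Y x1) + card (nbs E Y x2) = card (nbs E Y x1 \<union> nbs E Y x2) + card (nbs E Y x1 \<inter> nbs E Y x2)"
      using fin by (intro card_Un_Int) auto
    moreover have "card (nbs E Y x1 \<union> nbs E Y x2) \<le> card Y" using fin by (intro card_mono) auto
    ultimately have "2 \<le> card (nbs E Y x1 \<inter> nbs E Y x2)" using deg[OF x(1)] deg[OF x(2)] k by linarith
    then obtain y1 y2 where y: "y1 \<in> nbs E Y x1 \<inter> nbs E Y x2" "y2 \<in> nbs E Y x1 \<inter> nbs E Y x2" "y1 \<noteq> y2"
      using fin by (metis card_le_Suc0_iff_eq finite_Int finite_nbs not_less_eq_eq numeral_2_eq_2)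
    have "cyc B (X \<union> Y) [x1, y1, x2, y2]"
      using x y disj by (auto simp: cyc_def pth_Cons B_def intro: sym)
    moreover have "set [x1, y1, x2, y2] \<inter> X = {x1, x2}" "set [x1, y1, x2, y2] \<inter> Y = {y1, y2}"
      using x y disj by auto
    ultimately show ?thesis unfolding Good_def using x y by (intro exI[of _ "[x1, y1, x2, y2]"]) auto
  qed
  have "Good k" using k(2)
  proof (induction rule: dec_induct)
    case base show ?case by (rule \<open>Good 2\<close>)
  next
    case (step j) then show ?case using \<open>\<And>j. 2 \<le> j \<Longrightarrow> j < k \<Longrightarrow> Good j \<Longrightarrow> Good (Suc j)\<close> by blast
  qed
  then obtain cs where cs: "cyc B (X \<union> Y) cs" "card (set cs \<inter> X) = k" "card (set cs \<inter> Y) = k"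
    unfolding Good_def by blast
  have "set cs \<subseteq> X \<union> Y" "distinct cs" using cs by (auto simp: cyc_def pth_def)
  moreover from this have "set cs = (set cs \<inter> X) \<union> (set cs \<inter> Y)" by auto
  then have "card (set cs) = k + k"
    using card_Un_disjoint[of "set cs \<inter> X" "set cs \<inter> Y"] cs fin disj by auto
  ultimately have "length cs = 2 * k" using distinct_card[of cs] by simp
  moreover have "cyc E (X \<union> Y) cs" using cs(1) by (rule cyc_rel_mono) (simp add: B_def)
  ultimately show ?thesis by blast
qed

end

section \<open>Cycles through a vertex with few non-neighbours\<close>

text \<open>All left ends lie in the union, and the interval of the largest one adds
  \<open>d - 1\<close> points to the right of them.\<close>

lemma card_Un_intervals:
  fixes B :: "nat set"
  assumes "finite B" "B \<noteq> {}" "1 \<le> d"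
  shows "card B + d \<le> card (\<Union>b\<in>B. {b..<b + d}) + 1"
proof -
  define m where "m = Max B"
  have m: "m \<in> B" "\<And>b. b \<in> B \<Longrightarrow> b \<le> m" using assms by (auto simp: m_def)
  have "B \<subseteq> (\<Union>b\<in>B. {b..<b + d})" using assms(3) by auto
  moreover have "{m<..<m + d} \<subseteq> {m..<m + d}" by auto
  then have "{m<..<m + d} \<subseteq> (\<Union>b\<in>B. {b..<b + d})" using m(1) by blast
  ultimately have "B \<union> {m<..<m + d} \<subseteq> (\<Union>b\<in>B. {b..<b + d})" by simp
  then have "card (B \<union> {m<..<m + d}) \<le> card (\<Union>b\<in>B. {b..<b + d})"
    using assms by (intro card_mono) auto
  moreover have "card (B \<union> {m<..<m + d}) = card B + card {m<..<m + d}"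
    using assms(1) m(2) by (intro card_Un_disjoint) (auto dest: m(2))
  ultimately show ?thesis by simp
qed

text \<open>The bookkeeping of the path counts below: positions \<open>J\<close> on a path and
  vertices \<open>Z\<close> off it are charged to the vertices of \<open>A\<close> outside
  \<open>N\<close>.\<close>

lemma card_outside_le:
  assumes "finite A" "distinct xs" "set xs \<subseteq> A" "J \<subseteq> {..<length xs}" "\<And>i. i \<in> J \<Longrightarrow> xs ! i \<notin> N"
    "Z \<subseteq> A - set xs" "Z \<inter> N = {}"
  shows "card J + card Z \<le> card (A - N)"
proof -
  have "inj_on (\<lambda>i. xs ! i) J"
    using assms(2,4) by (meson inj_on_nth inj_on_subset lessThan_iff)
  then have "card ((\<lambda>i. xs ! i) ` J) = card J" by (rule card_image)
  moreover have "(\<lambda>i. xs ! i) ` J \<subseteq> set xs" using assms(4) by auto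
  moreover from this have "(\<lambda>i. xs ! i) ` J \<inter> Z = {}" using assms(6) by blast
  moreover have "(\<lambda>i. xs ! i) ` J \<union> Z \<subseteq> A - N"
  proof
    fix v assume "v \<in> (\<lambda>i. xs ! i) ` J \<union> Z"
    then show "v \<in> A - N" using assms(3,5,6,7) \<open>(\<lambda>i. xs ! i) ` J \<subseteq> set xs\<close> by blast
  qed
  then have "card ((\<lambda>i. xs ! i) ` J \<union> Z) \<le> card (A - N)" using assms(1) by (intro card_mono) auto
  moreover have "finite J" "finite Z" using assms(1,4,6) finite_subset by blast+
  ultimately show ?thesis by (simp add: card_Un_disjoint)
qed

text \<open>\<open>A\<close> is what is left of \<open>U\<close> without \<open>y\<close>, and
  \<open>N\<close> consists of the neighbours of \<open>y\<close>; \<open>noP\<close> says that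
  \<open>y\<close> closes no path to a cycle of length \<open>2 * k\<close>. Only vertices of
  \<open>N\<close> lose a neighbour when \<open>y\<close> is removed, hence their weaker degree
  bound. The assumptions turn out to be contradictory.\<close>

locale near_dominated = sgraph E for E :: "'a \<Rightarrow> 'a \<Rightarrow> bool" +
  fixes A N :: "'a set" and k :: nat
  assumes finA: "finite A" and NA: "N \<subseteq> A" and k3: "3 \<le> k"
    and degN: "x \<in> N \<Longrightarrow> k - 1 \<le> card (nbs E A x)"
    and degO: "x \<in> A - N \<Longrightarrow> k \<le> card (nbs E A x)"
    and few: "card (A - N) \<le> k - 1"
    and conn: "P \<subseteq> A \<Longrightarrow> P \<noteq> {} \<Longrightarrow> P \<noteq> A \<Longrightarrow> \<exists>x\<in>P. \<exists>y\<in>A - P. E x y"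
    and big: "2 * k - 1 \<le> card A"
    and noP: "pth E A ps \<Longrightarrow> length ps = 2 * k - 1 \<Longrightarrow> hd ps \<in> N \<Longrightarrow> last ps \<notin> N"
begin

lemma deg1: "x \<in> A \<Longrightarrow> k - 1 \<le> card (nbs E A x)"
  using degN[of x] degO[of x] by (cases "x \<in> N") auto

text \<open>A window of \<open>2k - 1\<close> consecutive vertices slides around a longer cycle, and each vertex
  outside \<open>N\<close> spoils at most two of its positions.\<close>

lemma cyc_length:
  assumes "cyc E A cs"
  shows "length cs \<le> 2 * k - 2"
proof (rule ccontr)
  assume q: "\<not> length cs \<le> 2 * k - 2"
  define s q where "s = 2 * k - 1" and "q = length cs"
  have sq: "s \<le> q" "2 \<le> s" using q k3 by (auto simp: s_def q_def)
  have d: "distinct cs" "set cs \<subseteq> A" using assms by (auto simp: cyc_def pth_def)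
  \<comment> \<open>A window starting at \<open>i\<close> is spoilt by its first vertex
    (\<open>b1\<close>) or by its last one (\<open>b2\<close>).\<close>
  define b1 b2 where "b1 = {i. i < q \<and> cs ! i \<notin> N}" and "b2 = {i. i < q \<and> rotate (s - 1) cs ! i \<notin> N}"
  have "card b1 + card ({} :: 'a set) \<le> card (A - N)"
    by (rule card_outside_le[OF finA d]) (auto simp: b1_def q_def)
  moreover have "card b2 + card ({} :: 'a set) \<le> card (A - N)"
    using d by (intro card_outside_le[OF finA, of "rotate (s - 1) cs"]) (auto simp: b2_def q_def)
  ultimately have "card b1 + card b2 \<le> 2 * (k - 1)" using few by simp
  then have "card b1 + card b2 < q" using sq(1) k3 unfolding s_def by linarith
  then have "card (b1 \<union> b2) < q" using card_Un_le[of b1 b2] by linarith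
  then have "b1 \<union> b2 \<noteq> {..<q}" by (metis card_lessThan less_irrefl)
  moreover have "b1 \<union> b2 \<subseteq> {..<q}" unfolding b1_def b2_def by blast
  ultimately obtain i where "i < q" "i \<notin> b1" "i \<notin> b2" by blast
  then have i: "i < q" "cs ! i \<in> N" "rotate (s - 1) cs ! i \<in> N"
    unfolding b1_def b2_def by blast+
  define cr where "cr = rotate i cs"
  have cr: "pth E A cr" "length cr = q"
    using cyc_rotate_n[OF assms, of i] by (auto simp: cr_def cyc_def q_def)
  have "pth E A (take s cr)" "length (take s cr) = s" using cr sq by (auto intro: pth_take)
  moreover have "cs \<noteq> []" using i by (auto simp: q_def)
  then have "hd cr = cs ! (i mod length cs)" unfolding cr_def by (rule hd_rotate_conv_nth)
  then have "hd (take s cr) = cs ! i"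
    using sq i by (simp add: q_def hd_take)
  moreover have "last (take s cr) = cr ! (s - 1)"
    using last_take_Suc[of "s - 1" cr] cr sq by simp
  moreover have "cr ! (s - 1) = rotate (s - 1) cs ! i"
    using sq i by (simp add: cr_def nth_rotate q_def add.commute)
  ultimately show False using noP[of "take s cr"] i by (simp add: s_def)
qed

lemma chord_le:
  assumes "pth E A xs" "b < length xs" "E (xs ! 0) (xs ! b)"
  shows "b \<le> 2 * k - 3"
proof (cases "2 \<le> b")
  case True
  then show ?thesis using cyc_length[OF chord_cyc[OF assms(1) True assms(2,3)]] assms by simp
next
  case False then show ?thesis using k3 by simp
qed

lemma hd_nbs_card:
  assumes "pth E A xs" "xs \<noteq> []"
  shows "card (nbs E A (xs ! 0)) \<le>
    card {b. 1 \<le> b \<and> b < length xs \<and> E (xs ! 0) (xs ! b)} + card (nbs E (A - set xs) (xs ! 0))"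
proof -
  let ?B = "{b. 1 \<le> b \<and> b < length xs \<and> E (xs ! 0) (xs ! b)}"
  have "nbs E A (xs ! 0) \<subseteq> (\<lambda>b. xs ! b) ` ?B \<union> nbs E (A - set xs) (xs ! 0)"
  proof
    fix w assume w: "w \<in> nbs E A (xs ! 0)"
    show "w \<in> (\<lambda>b. xs ! b) ` ?B \<union> nbs E (A - set xs) (xs ! 0)"
    proof (cases "w \<in> set xs")
      case True
      then obtain b where b: "b < length xs" "w = xs ! b" by (metis in_set_conv_nth)
      moreover have "b \<noteq> 0" using w b irr by (metis in_nbs)
      ultimately show ?thesis using w by auto
    qed (use w in auto)
  qed
  then have "card (nbs E A (xs ! 0)) \<le> card ((\<lambda>b. xs ! b) ` ?B \<union> nbs E (A - set xs) (xs ! 0))"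
    using finA by (intro card_mono) auto
  also have "\<dots> \<le> card ((\<lambda>b. xs ! b) ` ?B) + card (nbs E (A - set xs) (xs ! 0))"
    by (rule card_Un_le)
  also have "card ((\<lambda>b. xs ! b) ` ?B) \<le> card ?B" by (intro card_image_le) auto
  finally show ?thesis by simp
qed

text \<open>The counting step: \<open>xs\<close> starts with \<open>a\<close> and ends with \<open>c\<close> vertices of \<open>N\<close>, and no path with
  ends in \<open>N\<close> has between \<open>2k - 1\<close> and \<open>2k + g - 2\<close> vertices. Every neighbour of the first vertex
  then accounts for a vertex outside \<open>N\<close>, found by reversing an initial segment of \<open>xs\<close>.\<close>

lemma count:
  assumes xs: "pth E A xs" and len: "length xs + 3 = 2 * k + g + a + c"
    and pos: "1 \<le> a" "1 \<le> c" "1 \<le> g"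
    and left: "\<And>i. i < a \<Longrightarrow> xs ! i \<in> N"
    and right: "\<And>i. length xs - c \<le> i \<Longrightarrow> i < length xs \<Longrightarrow> xs ! i \<in> N"
    and forb: "\<And>ps. pth E A ps \<Longrightarrow> 2 * k - 1 \<le> length ps \<Longrightarrow> length ps < 2 * k - 1 + g \<Longrightarrow>
        hd ps \<in> N \<Longrightarrow> last ps \<notin> N"
    and noext: "\<And>w. w \<in> N \<Longrightarrow> w \<notin> set xs \<Longrightarrow> \<not> E (xs ! 0) w"
  shows "2 * g + c \<le> 3"
proof -
  \<comment> \<open>\<open>d\<close> is the length of the stretch right after the first
    \<open>a\<close> positions in which no vertex of \<open>N\<close> can occur.\<close>
  define s M d where "s = 2 * k - 1" and "M = length xs" and "d = g + c - 1"
  have M: "M + 2 = s + g + a + c" using len k3 by (simp add: s_def M_def)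
  have s5: "5 \<le> s" using k3 by (simp add: s_def)
  define e where "e = M - c"
  have Mc: "e + 2 = s + g + a" "e + c = M" "1 \<le> d" "d + 1 = g + c" using M pos s5 by (auto simp: d_def e_def)
  have seg: False if "pth E A ys" "j < length ys" "ys ! i \<in> N" "ys ! j \<in> N"
    "s + i \<le> j + 1" "j + 1 < s + g + i" for ys i j
  proof -
    have ij: "i \<le> j" using that(5) s5 by linarith
    have "s \<le> j - i + 1" "j - i + 1 < s + g" using that(5,6) ij by linarith+
    then show False
      using forb[OF segment(1)[OF that(1) ij that(2)]] segment[OF that(1) ij that(2)] that(3,4)
      by (simp add: s_def)
  qed
  \<comment> \<open>Every start \<open>i\<close> in the stretch has an end among the last
    \<open>c\<close> positions that gives a segment of forbidden length: \<open>e\<close> for the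
    first \<open>g\<close> starts, \<open>i + s - 1\<close> for the others. The path
    \<open>ys\<close> is arbitrary because rotations of \<open>xs\<close> are needed too.\<close>
  have pre: "ys ! i \<notin> N" if ys: "pth E A ys" "length ys = M" and
    r: "\<And>j. e \<le> j \<Longrightarrow> j < M \<Longrightarrow> ys ! j \<in> N" and i: "a \<le> i" "i < a + d" for ys i
  proof
    assume iN: "ys ! i \<in> N"
    show False
    proof (cases "i < a + g")
      case True
      then show False using seg[OF ys(1), of e i] r[of e] iN i ys(2) Mc s5 pos by linarith
    next
      case False
      then obtain j where j: "j + 1 = i + s" using s5 by (metis Suc_eq_plus1 add.commute add_Suc_right not0_implies_Suc not_numeral_le_zero add_0_right)
      then have "e \<le> j" "j < M" using False i Mc pos by linarith+
      then show False using seg[OF ys(1), of j i] r[of j] j iN ys(2) pos by linarith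
    qed
  qed
  \<comment> \<open>Likewise from the left: a vertex of \<open>N\<close> at such a position would
    end a forbidden segment that starts among the first \<open>a\<close>.\<close>
  define J1 where "J1 = {s - 1..<e}"
  have J1: "xs ! j \<notin> N" if "j \<in> J1" for j
  proof
    assume jN: "xs ! j \<in> N"
    have j: "s \<le> j + 1" "j < e" "j < length xs" using that Mc by (auto simp: J1_def M_def)
    show False
    proof (cases "j + 1 < s + a")
      case True
      obtain i where i: "j + 1 = s + i" using j(1) by (metis le_iff_add)
      then show False using seg[OF xs j(3), of i] left[of i] jN True pos by linarith
    next
      case False
      obtain i where i: "a = i + 1" using pos by (metis add.commute le_iff_add)
      then show False using seg[OF xs j(3), of i] left[of i] jN j Mc False by linarith
    qed
  qed
  have cJ1: "card J1 + 1 = g + a" using Mc pos s5 by (simp add: J1_def)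
  define Bs where "Bs = {b. 1 \<le> b \<and> b < length xs \<and> E (xs ! 0) (xs ! b)}"
  have Bs: "b \<le> s - 2" "1 \<le> b" "b < M" "E (xs ! 0) (xs ! b)" if "b \<in> Bs" for b
    using chord_le[OF xs, of b] that k3 by (auto simp: Bs_def s_def M_def)
  have chord: "xs ! (b - 1 - i) \<notin> N" if b: "b \<in> Bs" and i: "a \<le> i" "i < a + d" "i < b" for b i
  proof -
    note f = flip[OF xs Bs(2)[OF b] Bs(3)[OF b, unfolded M_def] Bs(4)[OF b]]
    have "flip xs b ! j \<in> N" if "e \<le> j" "j < M" for j
      using f(5)[of j] that right[of j] Bs(1)[OF b] Mc pos s5 by (simp add: M_def e_def)
    then have "flip xs b ! i \<notin> N" using pre[OF f(1)] f(2) i by (simp add: M_def)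
    then show ?thesis using f(4)[OF i(3)] by simp
  qed
  define Sm Bg where "Sm = {b \<in> Bs. b \<le> a}" and "Bg = {b \<in> Bs. a + d + 1 \<le> b}"
  \<comment> \<open>No chord has \<open>a < b \<le> a + d\<close>, since its rotation would carry
    \<open>xs ! 0\<close>, a vertex of \<open>N\<close>, into the stretch.\<close>
  have "b \<in> Sm \<union> Bg" if "b \<in> Bs" for b
  proof (rule ccontr)
    assume "b \<notin> Sm \<union> Bg"
    then have "a \<le> b - 1" "b - 1 < a + d" "b - 1 < b" using that by (auto simp: Sm_def Bg_def)
    then have "xs ! (b - 1 - (b - 1)) \<notin> N" using chord[OF that] by blast
    then show False using left[of 0] pos by simp
  qed
  moreover have finBs: "finite Bs" by (simp add: Bs_def)
  ultimately have "card Bs \<le> card (Sm \<union> Bg)" by (intro card_mono) (auto simp: Sm_def Bg_def)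
  also have "\<dots> \<le> card Sm + card Bg" by (rule card_Un_le)
  also have "card Sm \<le> card {1..a}" using Bs by (intro card_mono) (auto simp: Sm_def)
  finally have cBs: "card Bs \<le> a + card Bg" by simp
  define Off where "Off = nbs E (A - set xs) (xs ! 0)"
  have Off: "Off \<subseteq> A - set xs" "Off \<inter> N = {}" using noext by (auto simp: Off_def)
  have xsne: "xs \<noteq> []" using Mc pos by (auto simp: M_def)
  have "xs ! 0 \<in> A" using xsne pth_subset[OF xs] by (auto simp: subset_eq)
  then have deg: "k - 1 \<le> a + card Bg + card Off"
    using deg1[of "xs ! 0"] hd_nbs_card[OF xs xsne] cBs unfolding Bs_def Off_def by linarith
  have dx: "distinct xs" "set xs \<subseteq> A" using xs by (auto simp: pth_def)
  have non: "card J + card Off \<le> k - 1" if "J \<subseteq> {..<M}" "\<And>i. i \<in> J \<Longrightarrow> xs ! i \<notin> N" for J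
    using card_outside_le[OF finA dx that(1)[unfolded M_def] that(2) Off] few by (rule order_trans)
  show ?thesis
  proof (cases "Bg = {}")
    case True
    \<comment> \<open>Without long chords the stretch of \<open>xs\<close> itself replaces the
      positions that rotations would supply.\<close>
    have preX: "xs ! i \<notin> N" if "a \<le> i" "i < a + d" for i
      using pre[OF xs _ _ that] right by (simp add: M_def e_def)
    have "a + d \<le> M" using M Mc pos s5 by (simp add: d_def)
    then have "card {a..<a + d} + card Off \<le> k - 1" using preX by (intro non) auto
    moreover have J1M: "J1 \<subseteq> {..<M}" using Mc by (auto simp: J1_def)
    then have "card J1 + card Off \<le> k - 1" using J1 by (intro non) auto
    ultimately have "a + d \<le> s - 1" using cJ1 pos k3 by (simp add: s_def)
    then have "{a..<a + d} \<inter> J1 = {}" by (auto simp: J1_def)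
    then have "card ({a..<a + d} \<union> J1) = d + card J1"
      by (subst card_Un_disjoint) (auto simp: J1_def)
    moreover have "card ({a..<a + d} \<union> J1) + card Off \<le> k - 1"
      using \<open>a + d \<le> M\<close> J1M J1 preX by (intro non) auto
    ultimately have "d + card J1 + card Off \<le> k - 1" by simp
    moreover have "k - 1 \<le> a + card Off" using deg True by simp
    ultimately show ?thesis using cJ1 pos Mc by linarith
  next
    case False
    \<comment> \<open>By \<open>chord\<close>, a long chord at \<open>b\<close> keeps the
      \<open>d\<close> positions from \<open>b - a - d\<close> on free of \<open>N\<close>.\<close>
    define B' where "B' = (\<lambda>b. b - a - d) ` Bg"
    have finBg: "finite Bg" using finBs by (simp add: Bg_def)
    have "inj_on (\<lambda>b. b - a - d) Bg" by (auto simp: inj_on_def Bg_def)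
    then have cB': "card B' = card Bg" by (simp add: B'_def card_image)
    define J2 where "J2 = (\<Union>b\<in>B'. {b..<b + d})"
    have J2: "xs ! i \<notin> N \<and> i < s - 1" if iJ: "i \<in> J2" for i
    proof -
      obtain b where b: "b \<in> Bg" "b - a - d \<le> i" "i < b - a - d + d"
        using iJ by (auto simp: J2_def B'_def)
      then have bb: "b \<in> Bs" "a + d + 1 \<le> b" by (auto simp: Bg_def)
      have "xs ! (b - 1 - (b - 1 - i)) \<notin> N" using b bb by (intro chord) auto
      moreover have "b - 1 - (b - 1 - i) = i" using b bb by simp
      ultimately show ?thesis using b bb Bs(1)[OF bb(1)] by simp
    qed
    have cJ2: "card Bg + d \<le> card J2 + 1"
      unfolding J2_def cB'[symmetric] using finBg False Mc(3) by (intro card_Un_intervals) (auto simp: B'_def)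
    have fJ2: "finite J2" unfolding J2_def B'_def using finBg by auto
    have "J1 \<inter> J2 = {}" using J2 by (force simp: J1_def)
    then have "card (J1 \<union> J2) = card J1 + card J2" using fJ2 by (intro card_Un_disjoint) (auto simp: J1_def)
    moreover have "s - 1 \<le> M" using Mc pos by simp
    then have "card (J1 \<union> J2) + card Off \<le> k - 1"
      using J1 J2 Mc by (intro non) (fastforce simp: J1_def)+
    ultimately have "card J1 + card J2 + card Off \<le> k - 1" by simp
    \<comment> \<open>\<open>(g + a - 1) + (card Bg + d - 1) + card Off \<le> k - 1 \<le> a + card
      Bg + card Off\<close>, whence \<open>g + d \<le> 2\<close>.\<close>
    then show ?thesis using cJ1 cJ2 deg pos k3 Mc by linarith
  qed
qed

end

context near_dominated begin

lemma noP_segment: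
  assumes "pth E A xs" "j = i + (2 * k - 2)" "j < length xs" "xs ! i \<in> N"
  shows "xs ! j \<notin> N"
proof -
  have ij: "i \<le> j" "j - i + 1 = 2 * k - 1" using assms(2) k3 by auto
  note sg = segment[OF assms(1) ij(1) assms(3)]
  have "last (segment xs i j) \<notin> N"
    using assms(4) by (intro noP[OF sg(1)]) (simp_all only: sg ij)
  then show ?thesis unfolding sg(5) .
qed

text \<open>The borderline \<open>g = a = c = 1\<close> of \<open>count\<close>. Chords and off-path
  neighbours of \<open>xs ! 0\<close> account for \<open>k - 1\<close> vertices outside
  \<open>N\<close>, which is all there can be. So every vertex outside \<open>N\<close> sits at
  position \<open>2 * k - 2\<close>, or two places before the end of a chord, or off the path and
  adjacent to \<open>xs ! 0\<close>.\<close>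

lemma tight:
  assumes xs: "pth E A xs" and len: "length xs = 2 * k"
    and ends: "xs ! 0 \<in> N" "xs ! (2 * k - 1) \<in> N"
    and noext: "\<forall>w\<in>N - set xs. \<not> E (xs ! 0) w"
  shows "\<And>i. i < 2 * k \<Longrightarrow> xs ! i \<notin> N \<Longrightarrow> i \<noteq> 2 * k - 2 \<Longrightarrow>
      i + 2 \<le> 2 * k - 3 \<and> E (xs ! 0) (xs ! (i + 2))"
    "\<And>w. w \<in> A - N \<Longrightarrow> w \<notin> set xs \<Longrightarrow> E (xs ! 0) w"
    "xs ! 1 \<notin> N" "xs ! (2 * k - 2) \<notin> N" "card (A - N) = k - 1"
proof -
  have pre: "ys ! 1 \<notin> N" if ys: "pth E A ys" "length ys = 2 * k" "ys ! (2 * k - 1) \<in> N" for ys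
    using noP_segment[OF ys(1), of "2 * k - 1" 1] ys(2,3) k3 by fastforce
  show x1: "xs ! 1 \<notin> N" by (rule pre[OF xs len ends(2)])
  show x2: "xs ! (2 * k - 2) \<notin> N"
    by (rule noP_segment[OF xs _ _ ends(1)]) (use len k3 in auto)
  define Bs where "Bs = {b. 1 \<le> b \<and> b < length xs \<and> E (xs ! 0) (xs ! b)}"
  have Bs: "b \<le> 2 * k - 3" "1 \<le> b" "b < length xs" "E (xs ! 0) (xs ! b)" if "b \<in> Bs" for b
    using chord_le[OF xs, of b] that by (auto simp: Bs_def)
  have chord: "xs ! (b - 2) \<notin> N" if b: "b \<in> Bs" "2 \<le> b" for b
  proof -
    note f = flip[OF xs Bs(2-4)[OF b(1)]]
    have "flip xs b ! (2 * k - 1) \<in> N" using f(5)[of "2 * k - 1"] Bs(1)[OF b(1)] ends len k3 by simp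
    then have "flip xs b ! 1 \<notin> N" using pre[OF f(1)] f(2) len by simp
    then show ?thesis using f(4)[of 1] b by (simp add: numeral_2_eq_2)
  qed
  define Bg where "Bg = {b \<in> Bs. 3 \<le> b}"
  have finBs: "finite Bs" by (simp add: Bs_def)
  have "b \<noteq> 2" if "b \<in> Bs" for b using chord[OF that] ends(1) by auto
  then have "Bs \<subseteq> insert 1 Bg" using Bs(2) by (force simp: Bg_def)
  then have "card Bs \<le> card (insert 1 Bg)" using finBs by (intro card_mono) (auto simp: Bg_def)
  also have "\<dots> \<le> Suc (card Bg)" by (rule card_insert_le_m1) (auto simp: Bg_def)
  finally have cBs: "card Bs \<le> card Bg + 1" by simp
  define Off where "Off = nbs E (A - set xs) (xs ! 0)"
  have Off: "Off \<subseteq> A - set xs" "Off \<inter> N = {}" using noext by (auto simp: Off_def)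
  have dx: "distinct xs" "set xs \<subseteq> A" using xs by (auto simp: pth_def)
  have xsne: "xs \<noteq> []" using len k3 by auto
  then have "xs ! 0 \<in> A" using dx by (auto simp: subset_eq)
  then have deg: "k - 1 \<le> card Bg + 1 + card Off"
    using deg1[of "xs ! 0"] hd_nbs_card[OF xs xsne] cBs unfolding Bs_def Off_def by linarith
  define J where "J = insert (2 * k - 2) ((\<lambda>b. b - 2) ` Bg)"
  have Jlt: "b - 2 < 2 * k - 2" if "b \<in> Bg" for b using Bs(1)[of b] that k3 by (auto simp: Bg_def)
  have finBg: "finite Bg" using finBs by (simp add: Bg_def)
  have "card ((\<lambda>b. b - 2) ` Bg) = card Bg" by (intro card_image) (auto simp: inj_on_def Bg_def)
  moreover have "2 * k - 2 \<notin> (\<lambda>b. b - 2) ` Bg" using Jlt by force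
  ultimately have cJ: "card J = card Bg + 1" using finBg by (simp add: J_def)
  have JM: "J \<subseteq> {..<length xs}" using Jlt len k3 by (fastforce simp: J_def)
  have JN: "xs ! i \<notin> N" if "i \<in> J" for i using that chord x2 by (auto simp: J_def Bg_def)
  have le: "card J + card Off \<le> card (A - N)" by (rule card_outside_le[OF finA dx JM JN Off])
  show eq: "card (A - N) = k - 1" using le few deg cJ by linarith
  define T where "T = (\<lambda>i. xs ! i) ` J \<union> Off"
  have injJ: "inj_on (\<lambda>i. xs ! i) J" using dx JM by (meson inj_on_nth lessThan_iff subsetD)
  have JX: "(\<lambda>i. xs ! i) ` J \<subseteq> set xs" using JM by auto
  have "card T = card ((\<lambda>i. xs ! i) ` J) + card Off"
    unfolding T_def using JX Off(1) finA finBg finite_subset[OF Off(1)] by (intro card_Un_disjoint) (auto simp: J_def)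
  then have "card T = card J + card Off" using card_image[OF injJ] by simp
  then have "card (A - N) \<le> card T" using eq deg cJ by linarith
  moreover have "T \<subseteq> A - N" using JX JN Off dx by (auto simp: T_def)
  ultimately have T: "T = A - N" using finA by (metis card_seteq finite_Diff)
  show "E (xs ! 0) w" if "w \<in> A - N" "w \<notin> set xs" for w
  proof -
    have "w \<in> T" using that(1) T by simp
    then show ?thesis using that(2) JX by (auto simp: T_def Off_def)
  qed
  show "i + 2 \<le> 2 * k - 3 \<and> E (xs ! 0) (xs ! (i + 2))" if i: "i < 2 * k" "xs ! i \<notin> N" "i \<noteq> 2 * k - 2" for i
  proof -
    have "xs ! i \<in> T" "xs ! i \<in> set xs" using T dx i len by auto
    then have "xs ! i \<in> (\<lambda>i. xs ! i) ` J" using Off by (auto simp: T_def)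
    then obtain j where "j \<in> J" "xs ! i = xs ! j" by auto
    then have "i \<in> J" using dx(1) JM i len by (metis lessThan_iff nth_eq_iff_index_eq subsetD)
    then obtain b where "b \<in> Bg" "i = b - 2" using i by (auto simp: J_def)
    then have "b \<in> Bs" "i + 2 = b" by (auto simp: Bg_def)
    then show ?thesis using Bs[of b] by simp
  qed
qed

lemma longest_path:
  obtains xs where "pth E A xs" "xs \<noteq> []" "\<And>ys. pth E A ys \<Longrightarrow> length ys \<le> length xs"
proof -
  obtain x where "x \<in> A" using big k3 by fastforce
  then have "pth E A [x]" by simp
  then obtain xs where "pth E A xs \<and> xs \<noteq> []" "\<And>ys. pth E A ys \<and> ys \<noteq> [] \<Longrightarrow> length ys \<le> length xs"
    using ex_has_greatest_nat[of "\<lambda>xs. pth E A xs \<and> xs \<noteq> []" "[x]" length "card A + 1"]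
      pth_length_le[OF _ finA] by (metis less_Suc_eq_le list.discI Suc_eq_plus1)
  then show ?thesis using that by (metis le0 list.size(3))
qed

lemma longest_path_nbs:
  assumes "pth E A xs" "xs \<noteq> []" "\<And>ys. pth E A ys \<Longrightarrow> length ys \<le> length xs"
  shows "nbs E (A - set xs) (xs ! 0) = {}"
proof (rule ccontr)
  assume "\<not> ?thesis"
  then obtain w where "w \<in> A" "w \<notin> set xs" "E (xs ! 0) w" by auto
  then have "pth E A (w # xs)" using assms(1,2) sym by (auto simp: pth_Cons hd_conv_nth)
  then show False using assms(3) by fastforce
qed

text \<open>Dirac's argument: on a shorter path the two end degrees of at least \<open>k - 1\<close>
  force crossing chords and so a closed tour of its vertices. Connectivity gives an edge leaving the
  tour, and opening the tour there produces a longer path.\<close>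

lemma longest_path_length:
  assumes xs: "pth E A xs" "xs \<noteq> []" "\<And>ys. pth E A ys \<Longrightarrow> length ys \<le> length xs"
  shows "2 * k - 1 \<le> length xs"
proof (rule ccontr)
  assume short: "\<not> ?thesis"
  define M where "M = length xs"
  have M: "M \<le> 2 * k - 2" "1 \<le> M" using short xs(2) by (auto simp: M_def Suc_le_eq)
  have dx: "distinct xs" "set xs \<subseteq> A" using xs by (auto simp: pth_def)
  define B B' where "B = {b. 1 \<le> b \<and> b < M \<and> E (xs ! 0) (xs ! b)}"
    and "B' = {b. 1 \<le> b \<and> b < M \<and> E (rev xs ! 0) (rev xs ! b)}"
  have B1: "k - 1 \<le> card B"
    using hd_nbs_card[OF xs(1,2)] longest_path_nbs[OF xs] deg1[of "xs ! 0"] dx xs(2)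
    by (auto simp: B_def M_def subset_eq)
  have rv: "pth E A (rev xs)" "rev xs \<noteq> []" "\<And>ys. pth E A ys \<Longrightarrow> length ys \<le> length (rev xs)"
    using xs by auto
  have "rev xs ! 0 \<in> A" using rv(2) dx by (metis length_greater_0_conv nth_mem set_rev subsetD)
  then have B2: "k - 1 \<le> card B'"
    using hd_nbs_card[OF rv(1,2)] longest_path_nbs[OF rv] deg1[of "rev xs ! 0"]
    by (auto simp: B'_def M_def)
  define B2 where "B2 = (\<lambda>b. M - b) ` B'"
  have "card B2 = card B'" unfolding B2_def by (intro card_image) (auto simp: inj_on_def B'_def)
  moreover have "finite B" "finite B2" by (auto simp: B_def B2_def B'_def)
  then have "card B + card B2 = card (B \<union> B2) + card (B \<inter> B2)" by (rule card_Un_Int)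
  moreover have "card (B \<union> B2) \<le> card {1..<M}" by (intro card_mono) (auto simp: B_def B2_def B'_def)
  ultimately have "card (B \<inter> B2) \<noteq> 0" using B1 B2 M k3 by simp
  then obtain b where "b \<in> B" "b \<in> B2" by (metis Int_iff card.empty ex_in_conv)
  then have b: "1 \<le> b" "b < M" "E (xs ! 0) (xs ! b)" "E (rev xs ! 0) (rev xs ! (M - b))"
    by (auto simp: B_def B2_def B'_def)
  have e2: "E (xs ! (M - 1)) (xs ! (b - 1))" using b xs(2) by (simp add: rev_nth M_def)
  define ds where "ds = take b xs @ rev (drop b xs)"
  have lds: "length ds = M" "set ds = set xs" using b unfolding ds_def M_def
    by (auto simp: set_take_disj_set_drop_if_distinct)
      (metis append_take_drop_id set_append Un_iff)+
  have cds: "pth E A ds \<and> E (last ds) (hd ds)"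
  proof -
    have "set (take b xs) \<inter> set (drop b xs) = {}"
      using dx(1) by (metis append_take_drop_id distinct_append)
    moreover have "last (take b xs) = xs ! (b - 1)" using last_take_Suc[of "b - 1" xs] b by (simp add: M_def)
    moreover have "hd (rev (drop b xs)) = xs ! (M - 1)" "last (rev (drop b xs)) = xs ! b"
      using b by (auto simp: hd_rev last_rev last_conv_nth hd_drop_conv_nth M_def)
    moreover have "hd ds = xs ! 0" using b xs(2) by (cases xs) (auto simp: ds_def M_def)
    ultimately show ?thesis using xs(1) b e2 sym unfolding ds_def
      by (auto simp: pth_append pth_take pth_drop M_def)
  qed
  have "set xs \<noteq> A" using big M k3 distinct_card[OF dx(1)] by (auto simp: M_def)
  moreover have "set xs \<noteq> {}" using xs(2) by simp
  ultimately obtain x w where w: "x \<in> set xs" "w \<in> A - set xs" "E x w" using conn[OF dx(2)] by blast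
  then obtain i where i: "i < M" "ds ! i = x" using lds by (metis in_set_conv_nth)
  define P Q where "P = take i ds" and "Q = drop i ds"
  have PQ: "ds = P @ Q" "Q \<noteq> []" "hd Q = x" using i lds by (auto simp: P_def Q_def hd_drop_conv_nth)
  have "pth E A (w # Q @ P)"
    using cds PQ w lds sym by (cases "P = []") (auto simp: pth_Cons pth_append)
  then show False using xs(3)[of "w # Q @ P"] PQ lds by (auto simp: M_def)
qed

text \<open>A first vertex outside \<open>N\<close> has at least \<open>k\<close> neighbours, all on
  the path. The rotations then offer \<open>k\<close> different first vertices, of which at most
  \<open>k - 1\<close> are outside \<open>N\<close>.\<close>

lemma longest_path_start:
  assumes xs: "pth E A xs" "xs \<noteq> []" "\<And>ys. pth E A ys \<Longrightarrow> length ys \<le> length xs"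
  obtains ys where "pth E A ys" "length ys = length xs" "hd ys \<in> N" "last ys = last xs"
proof (cases "xs ! 0 \<in> N")
  case True
  then show ?thesis using that[of xs] xs by (simp add: hd_conv_nth)
next
  case False
  have dx: "distinct xs" "set xs \<subseteq> A" using xs by (auto simp: pth_def)
  define B where "B = {b. 1 \<le> b \<and> b < length xs \<and> E (xs ! 0) (xs ! b)}"
  have "xs ! 0 \<in> A" using dx xs(2) by (auto simp: subset_eq)
  then have "k \<le> card B"
    using hd_nbs_card[OF xs(1,2)] longest_path_nbs[OF xs] degO[of "xs ! 0"] False by (simp add: B_def)
  moreover have "card ((\<lambda>b. b - 1) ` B) = card B" by (intro card_image) (auto simp: inj_on_def B_def)
  moreover have "card ((\<lambda>b. b - 1) ` B) + card ({} :: 'a set) \<le> card (A - N)"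
    if "\<And>b. b \<in> B \<Longrightarrow> xs ! (b - 1) \<notin> N"
    using that by (intro card_outside_le[OF finA dx]) (auto simp: B_def)
  ultimately obtain b where "b \<in> B" "xs ! (b - 1) \<in> N" using few k3 by fastforce
  then show ?thesis using that[of "flip xs b"] flip[OF xs(1), of b] by (auto simp: B_def)
qed

text \<open>Among paths with both ends in \<open>N\<close> and at least \<open>2 * k - 1\<close>
  vertices, a shortest one has \<open>2 * k - 1 + g\<close> vertices. Three applications of
  \<open>count\<close> reduce to \<open>g = 1\<close> and a path on \<open>2 * k\<close> vertices
  that cannot be prolonged within \<open>N\<close>; \<open>tight\<close> from both ends then gives
  too many excluded positions.\<close>

lemma contradiction: False
proof -
  define s where "s = 2 * k - 1"
  have s5: "5 \<le> s" using k3 by (simp add: s_def)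
  define NN where "NN m \<longleftrightarrow> s \<le> m \<and> (\<exists>ps. pth E A ps \<and> length ps = m \<and> hd ps \<in> N \<and> last ps \<in> N)" for m
  have "\<exists>m. NN m"
  proof -
    obtain xs where xs: "pth E A xs" "xs \<noteq> []" "\<And>ys. pth E A ys \<Longrightarrow> length ys \<le> length xs"
      by (rule longest_path) blast
    obtain ys where ys: "pth E A ys" "length ys = length xs" "hd ys \<in> N"
      by (rule longest_path_start[OF xs]) blast
    have ysne: "ys \<noteq> []" using ys xs by auto
    have ry: "pth E A (rev ys)" "rev ys \<noteq> []" "\<And>zs. pth E A zs \<Longrightarrow> length zs \<le> length (rev ys)"
      using ys xs ysne by auto
    obtain zs where zs: "pth E A zs" "length zs = length (rev ys)" "hd zs \<in> N" "last zs = last (rev ys)"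
      by (rule longest_path_start[OF ry])
    moreover have "s \<le> length zs" using longest_path_length[OF xs] zs ys by (simp add: s_def)
    ultimately show ?thesis using ys ysne unfolding NN_def by (metis last_rev)
  qed
  then have least: "NN (LEAST m. NN m)" "\<And>m. NN m \<Longrightarrow> (LEAST m. NN m) \<le> m"
    by (auto intro: LeastI_ex Least_le)
  define m where "m = (LEAST m. NN m)"
  have mNN: "NN m" and mmin: "\<And>m'. NN m' \<Longrightarrow> m \<le> m'" using least by (auto simp: m_def)
  obtain ps where ps: "pth E A ps" "length ps = m" "hd ps \<in> N" "last ps \<in> N" "s \<le> m"
    using mNN unfolding NN_def by blast
  have "m \<noteq> s" using noP[OF ps(1)] ps by (auto simp: s_def)
  then obtain g where g: "m = s + g" "1 \<le> g" using ps(5) by (metis Suc_eq_plus1 add_0_right le_iff_add le_add2 not0_implies_Suc)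
  have forb: "last qs \<notin> N" if "pth E A qs" "2 * k - 1 \<le> length qs" "length qs < 2 * k - 1 + g" "hd qs \<in> N" for qs
    using mmin[of "length qs"] that g unfolding NN_def s_def by (metis not_le)
  \<comment> \<open>Prepending vertices of \<open>N\<close> as long as possible supplies the
    hypothesis \<open>noext\<close> of \<open>count\<close>.\<close>
  define Ex where "Ex L \<longleftrightarrow> pth E A (L @ ps) \<and> set L \<subseteq> N" for L
  have "Ex []" using ps by (simp add: Ex_def)
  moreover have "length L < card A + 1" if "Ex L" for L
    using pth_length_le[OF _ finA, of E "L @ ps"] that by (auto simp: Ex_def)
  ultimately obtain L where L: "Ex L" "\<And>L'. Ex L' \<Longrightarrow> length L' \<le> length L"
    using ex_has_greatest_nat[of Ex "[]" length "card A + 1"] by blast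
  define xs a where "xs = L @ ps" and "a = length L + 1"
  have psne: "ps \<noteq> []" using ps s5 by auto
  have xs: "pth E A xs" "length xs = m + length L" "xs \<noteq> []" using L ps psne by (auto simp: Ex_def xs_def)
  have noext: "\<not> E (xs ! 0) w" if "w \<in> N" "w \<notin> set xs" for w
  proof
    assume "E (xs ! 0) w"
    then have "Ex (w # L)" using L(1) that NA xs(3) sym
      by (auto simp: Ex_def pth_Cons hd_conv_nth simp flip: xs_def)
    then show False using L(2) by fastforce
  qed
  have left: "xs ! i \<in> N" if "i < a" for i
  proof (cases "i < length L")
    case True then show ?thesis using L(1) by (auto simp: Ex_def xs_def nth_append subset_eq)
  next
    case False
    then have "i = length L" using that by (simp add: a_def)
    then show ?thesis using ps psne by (simp add: xs_def nth_append hd_conv_nth)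
  qed
  have lastN: "last xs \<in> N" using ps psne by (simp add: xs_def)
  have len3: "length xs + 3 = 2 * k + g + a + 1" using xs g k3 by (simp add: a_def s_def)
  have "2 * g + 1 \<le> 3"
  proof (rule count[OF xs(1) len3])
    show "xs ! i \<in> N" if "length xs - 1 \<le> i" "i < length xs" for i
    proof -
      have "i = length xs - 1" using that by simp
      then show ?thesis using lastN xs(3) by (simp add: last_conv_nth)
    qed
  qed (use left forb noext g a_def in auto)
  then have g1: "g = 1" using g by simp
  have noextR: "\<not> E (last xs) w" if w: "w \<in> N" "w \<notin> set xs" for w
  proof
    assume Ew: "E (last xs) w"
    \<comment> \<open>Appending \<open>w\<close> would put two vertices of \<open>N\<close> at the
      end, so \<open>c = 2\<close>.\<close>
    have "2 * g + 2 \<le> 3"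
    proof (rule count)
      show "pth E A (xs @ [w])" using xs Ew w NA by (auto simp: pth_append)
      show "length (xs @ [w]) + 3 = 2 * k + g + a + 2" using len3 by simp
      show "(xs @ [w]) ! i \<in> N" if "i < a" for i
        using left[OF that] that xs(2) ps(5) s5 by (simp add: nth_append a_def)
      show "(xs @ [w]) ! i \<in> N" if "length (xs @ [w]) - 2 \<le> i" "i < length (xs @ [w])" for i
      proof (cases "i = length xs")
        case False
        then have "i = length xs - 1" using that by simp
        then show ?thesis using lastN xs(3) by (simp add: last_conv_nth nth_append)
      qed (use w in simp)
      show "\<not> E ((xs @ [w]) ! 0) v" if "v \<in> N" "v \<notin> set (xs @ [w])" for v
        using noext[of v] that xs(3) by (simp add: nth_append)
    qed (use forb g a_def in auto)
    then show False using g by simp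
  qed
  have "a \<le> 1"
  proof -
    \<comment> \<open>Reversal exchanges \<open>a\<close> with \<open>c = 1\<close>;
      \<open>noextR\<close> now serves as \<open>noext\<close>.\<close>
    have "2 * g + a \<le> 3"
    proof (rule count)
      show "pth E A (rev xs)" using xs by simp
      show "length (rev xs) + 3 = 2 * k + g + 1 + a" using len3 by simp
      show "rev xs ! i \<in> N" if "i < 1" for i
        using that lastN xs(3) by (simp add: rev_nth last_conv_nth)
      show "rev xs ! i \<in> N" if "length (rev xs) - a \<le> i" "i < length (rev xs)" for i
        using that left[of "length xs - Suc i"] by (simp add: rev_nth)
      show "\<not> E (rev xs ! 0) w" if "w \<in> N" "w \<notin> set (rev xs)" for w
        using noextR[of w] that xs(3) by (simp add: rev_nth last_conv_nth)
    qed (use forb g a_def in auto)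
    then show ?thesis using g1 by simp
  qed
  then have lx: "length xs = 2 * k" using len3 g1 by (simp add: a_def)
  have e0: "xs ! 0 \<in> N" "xs ! (2 * k - 1) \<in> N"
    using left[of 0] lastN lx xs(3) by (auto simp: a_def last_conv_nth)
  have "\<forall>w\<in>N - set xs. \<not> E (xs ! 0) w" using noext by blast
  note t = tight[OF xs(1) lx e0 this]
  have re: "rev xs ! i = xs ! (2 * k - 1 - i)" if "i < 2 * k" for i
    using that lx by (simp add: rev_nth)
  have ends: "rev xs ! 0 = last xs" "rev xs ! (2 * k - 1) = xs ! 0"
    using re[of 0] re[of "2 * k - 1"] xs(3) lx k3 by (simp_all add: last_conv_nth)
  have r0: "pth E A (rev xs)" "length (rev xs) = 2 * k" "rev xs ! 0 \<in> N" "rev xs ! (2 * k - 1) \<in> N"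
    "\<forall>w\<in>N - set (rev xs). \<not> E (rev xs ! 0) w"
    unfolding ends using xs(1) lx e0 noextR lastN by auto
  note tr = tight[OF r0]
  have tr1: "4 \<le> i \<and> E (xs ! (2 * k - 1)) (xs ! (i - 2))" if i: "i < 2 * k" "xs ! i \<notin> N" "i \<noteq> 1" for i
  proof -
    define j where "j = 2 * k - 1 - i"
    have j: "j < 2 * k" "rev xs ! j \<notin> N" "j \<noteq> 2 * k - 2"
      using i re[of j] k3 by (auto simp: j_def)
    have *: "j + 2 \<le> 2 * k - 3" "E (rev xs ! 0) (rev xs ! (j + 2))" using tr(1)[OF j] by auto
    have "2 * k - 1 - (j + 2) = i - 2" "4 \<le> i" using *(1) i by (auto simp: j_def)
    then show ?thesis using * re[of 0] re[of "j + 2"] k3 by simp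
  qed
  have dx: "distinct xs" "set xs \<subseteq> A" using xs by (auto simp: pth_def)
  \<comment> \<open>An off-path vertex outside \<open>N\<close> is adjacent to both ends by
    \<open>tight\<close> and closes a cycle on \<open>2 * k + 1\<close> vertices.\<close>
  have cover: "A - N \<subseteq> set xs"
  proof
    fix w assume w: "w \<in> A - N"
    show "w \<in> set xs"
    proof (rule ccontr)
      assume wx: "w \<notin> set xs"
      have "E (xs ! 0) w" "E (rev xs ! 0) w" using t(2)[OF w wx] tr(2)[OF w] wx by auto
      then have "E (last xs) w" "E w (hd xs)" using ends(1) xs(3) sym by (auto simp: hd_conv_nth)
      then have "cyc E A (xs @ [w])"
        using xs(1,3) w wx lx k3 by (auto simp: cyc_def pth_append)
      then show False using cyc_length[of "xs @ [w]"] lx by simp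
    qed
  qed
  define Z where "Z = {i. i < 2 * k \<and> xs ! i \<notin> N}"
  have "(\<lambda>i. xs ! i) ` Z = A - N" using cover dx lx by (fastforce simp: Z_def in_set_conv_nth)
  moreover have "inj_on (\<lambda>i. xs ! i) Z" using dx lx by (auto simp: inj_on_def Z_def nth_eq_iff_index_eq)
  ultimately have cZ: "card Z = k - 1" using t(5) by (metis card_image)
  have Z1: "1 \<in> Z" "2 * k - 2 \<in> Z" using t(3,4) k3 by (auto simp: Z_def)
  have hi: "i + 2 \<le> 2 * k - 3" "E (xs ! 0) (xs ! (i + 2))" if "i \<in> Z" "i \<noteq> 2 * k - 2" for i
    using t(1)[of i] that by (auto simp: Z_def)
  have lo: "4 \<le> i" "E (xs ! (2 * k - 1)) (xs ! (i - 2))" if "i \<in> Z" "i \<noteq> 1" for i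
    using tr1[of i] that by (auto simp: Z_def)
  \<comment> \<open>The chords belonging to \<open>i\<close> and \<open>i + d\<close> start at
    opposite ends and cross; the resulting cycle has \<open>2 * k + d - 3\<close> vertices, more
    than \<open>cyc_length\<close> permits.\<close>
  have sep: "i + d \<notin> Z" if i: "i \<in> Z" "i \<noteq> 2 * k - 2" and d: "d = 2 \<or> d = 3" for i d
  proof
    assume "i + d \<in> Z"
    moreover have "i + d \<noteq> 1" using d by auto
    ultimately have *: "E (xs ! (2 * k - 1)) (xs ! (i + d - 2))" using lo by blast
    have "cyc E A (take (i + d - 2 + 1) xs @ rev (drop (i + 2) xs))"
      using hi[OF i] lx d * k3 by (intro two_chords_cyc[OF xs(1)]) auto
    from cyc_length[OF this] show False using lx hi[OF i] d k3 by auto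
  qed
  define Z0 where "Z0 = Z - {2 * k - 2}"
  have finZ: "finite Z" by (simp add: Z_def)
  have cZ0: "card Z0 + 1 = card Z" using Z1 finZ unfolding Z0_def
    by (metis Suc_eq_plus1 card_Suc_Diff1)
  have Z0ne: "1 \<in> Z0" using Z1 k3 by (auto simp: Z0_def)
  \<comment> \<open>The positions that \<open>sep\<close> excludes from \<open>Z\<close>; as a union
    of intervals of length two there are at least \<open>card Z0 + 1 = k - 1\<close> of
    them.\<close>
  define C where "C = (\<Union>b\<in>(\<lambda>i. i + 2) ` Z0. {b..<b + 2})"
  have Cmem: "\<exists>i\<in>Z0. c = i + 2 \<or> c = i + 3" if c: "c \<in> C" for c
  proof -
    obtain i where i: "i \<in> Z0" "i + 2 \<le> c" "c < i + 2 + 2" using c by (auto simp: C_def)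
    then have "c = i + 2 \<or> c = i + 3" by linarith
    then show ?thesis using i(1) by blast
  qed
  have "card ((\<lambda>i. i + 2) ` Z0) + 2 \<le> card C + 1"
    unfolding C_def using finZ Z0ne by (intro card_Un_intervals) (auto simp: Z0_def)
  moreover have "card ((\<lambda>i. i + 2) ` Z0) = card Z0" by (intro card_image) (simp add: inj_on_def)
  ultimately have cC: "card Z0 + 1 \<le> card C" by simp
  have CZ: "C \<inter> Z = {}" using Cmem sep by (fastforce simp: Z0_def)
  have C3: "3 \<le> c" "c \<le> 2 * k - 2" if c: "c \<in> C" for c
  proof -
    obtain i where i: "i \<in> Z0" "c = i + 2 \<or> c = i + 3" using Cmem[OF c] by blast
    have "i \<noteq> 0" using i(1) e0(1) by (cases i) (auto simp: Z0_def Z_def)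
    then show "3 \<le> c" using i by auto
    show "c \<le> 2 * k - 2" using i hi(1)[of i] by (auto simp: Z0_def)
  qed
  have Zr: "1 \<le> i" "i \<le> 2 * k - 2" "i \<noteq> 2" if "i \<in> Z" for i
  proof -
    have i: "i < 2 * k" "xs ! i \<notin> N" using that by (auto simp: Z_def)
    show "1 \<le> i" using i(2) e0(1) by (cases i) auto
    have "i \<noteq> 2 * k - 1" using i(2) e0(2) by auto
    then show "i \<le> 2 * k - 2" using i(1) by linarith
    show "i \<noteq> 2" using lo(1)[OF that] by auto
  qed
  have finC: "finite C" using finZ by (auto simp: C_def Z0_def)
  \<comment> \<open>\<open>Z\<close>, \<open>C\<close> and position 2 are disjoint and would need
    \<open>2 * k - 1\<close> of the \<open>2 * k - 2\<close> inner positions.\<close>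
  have "card (C \<union> Z \<union> {2}) = card (C \<union> Z) + card {2::nat}"
    using finC finZ Zr C3 by (intro card_Un_disjoint) fastforce+
  also have "card (C \<union> Z) = card C + card Z" using finC finZ CZ by (intro card_Un_disjoint) auto
  finally have "card C + card Z + 1 = card (C \<union> Z \<union> {2})" by simp
  also have "\<dots> \<le> card {1..2 * k - 2}" using Zr C3 k3 by (intro card_mono) fastforce+
  finally show False using cC cZ0 cZ k3 by simp
qed

end

section \<open>Cut vertices and the deletion of non-neighbours\<close>

definition conn :: "('a \<Rightarrow> 'a \<Rightarrow> bool) \<Rightarrow> 'a set \<Rightarrow> bool" where
  "conn E A \<longleftrightarrow> (\<forall>P\<subseteq>A. P \<noteq> {} \<longrightarrow> P \<noteq> A \<longrightarrow> (\<exists>x\<in>P. \<exists>y\<in>A - P. E x y))"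

context sgraph begin

text \<open>A side \<open>P\<close> may be a union of several components of \<open>A - {v}\<close>,
  which makes complements of sides sides again.\<close>

definition cut :: "'a set \<Rightarrow> 'a \<Rightarrow> 'a set \<Rightarrow> bool" where
  "cut A v P \<longleftrightarrow> v \<in> A \<and> P \<subseteq> A - {v} \<and> P \<noteq> {} \<and> P \<noteq> A - {v} \<and>
     (\<forall>x\<in>P. \<forall>z\<in>A - {v} - P. \<not> E x z)"

lemma cut_compl: "cut A v P \<Longrightarrow> cut A v (A - {v} - P)"
  unfolding cut_def using sym by blast

lemma cut_card:
  assumes "finite A" "cut A v P" "\<And>x. x \<in> A \<Longrightarrow> k \<le> card (nbs E A x)"
  shows "k \<le> card P"
proof -
  obtain x where x: "x \<in> P" using assms(2) by (auto simp: cut_def)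
  have finP: "finite P" using assms(1,2) finite_subset by (auto simp: cut_def)
  have "nbs E A x \<subseteq> insert v (P - {x})" using assms(2) x irr by (auto simp: cut_def)
  then have "card (nbs E A x) \<le> card (insert v (P - {x}))" using finP by (intro card_mono) auto
  also have "\<dots> \<le> Suc (card (P - {x}))" by (rule card_insert_le_m1) (auto simp: finP)
  also have "\<dots> = card P" using finP x by (metis card_Suc_Diff1)
  finally show ?thesis using assms(2,3) x by (fastforce simp: cut_def)
qed

text \<open>Descending to smaller and smaller sides of cut vertices ends in a side inside \<open>N\<close>.\<close>

lemma cut_side_in:
  assumes "finite A" "conn E A" "\<And>v. v \<in> A - N \<Longrightarrow> \<exists>P. cut A v P"
    and "cut A v P"
  shows "\<exists>w Q. cut A w Q \<and> Q \<subseteq> P \<and> Q \<subseteq> N"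
  using assms(4)
proof (induction "card P" arbitrary: v P rule: less_induct)
  case less
  show ?case
  proof (cases "P \<subseteq> N")
    case True then show ?thesis using less.prems by blast
  next
    case False
    have PA: "P \<subseteq> A - {v}" "v \<in> A" using less.prems by (auto simp: cut_def)
    then obtain w where w: "w \<in> P" "w \<in> A - N" using False by auto
    obtain Q0 where Q0: "cut A w Q0" using assms(3)[OF w(2)] by blast
    define Q where "Q = (if v \<in> Q0 then A - {w} - Q0 else Q0)"
    have Q: "cut A w Q" "v \<notin> Q" using Q0 cut_compl[OF Q0] by (auto simp: Q_def)
    have "Q \<subseteq> P"
    proof (rule ccontr)
      assume "\<not> Q \<subseteq> P"
      \<comment> \<open>No edge leaves \<open>T\<close>: the cut at \<open>v\<close> keeps it away
        from \<open>P\<close>, and the cut at \<open>w\<close>, which lies in \<open>P\<close>,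
        keeps it inside \<open>Q\<close>.\<close>
      define T where "T = Q - P"
      have "T \<noteq> {}" "T \<subseteq> A" "T \<noteq> A" using \<open>\<not> Q \<subseteq> P\<close> Q PA by (auto simp: T_def cut_def)
      then obtain x z where xz: "x \<in> T" "z \<in> A - T" "E x z" using assms(2) unfolding conn_def by blast
      have x: "x \<in> Q" "x \<in> A - {v} - P" using xz(1) Q by (auto simp: T_def cut_def)
      have "z \<notin> P" using less.prems x(2) xz(3) sym unfolding cut_def by blast
      moreover have "z \<in> Q \<or> z = w" using Q(1) x(1) xz unfolding cut_def by blast
      ultimately show False using xz(2) w(1) by (auto simp: T_def)
    qed
    moreover have "w \<notin> Q" using Q by (auto simp: cut_def)
    ultimately have "Q \<subset> P" using w by auto
    moreover have "finite P" using PA assms(1) finite_subset by blast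
    ultimately have "card Q < card P" by (intro psubset_card_mono)
    from less.hyps[OF this Q(1)] \<open>Q \<subseteq> P\<close> show ?thesis by blast
  qed
qed

text \<open>Otherwise both sides of a cut vertex contain, by \<open>cut_side_in\<close>, a side
  lying inside \<open>N\<close>. Each has at least \<open>k\<close> vertices by
  \<open>cut_card\<close>, so together with \<open>A - N\<close> they need \<open>3 * k\<close>
  vertices.\<close>

lemma non_cut_vertex:
  assumes fin: "finite A" and conn: "conn E A" and N: "N \<subseteq> A"
    and deg: "\<And>x. x \<in> A \<Longrightarrow> k \<le> card (nbs E A x)"
    and card: "card A < 3 * k" "k \<le> card (A - N)" "1 \<le> k"
  shows "\<exists>v\<in>A - N. conn E (A - {v})"
proof (rule ccontr)
  assume no: "\<not> ?thesis"
  have cuts: "\<exists>P. cut A v P" if "v \<in> A - N" for v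
  proof -
    have "\<not> conn E (A - {v})" using no that by blast
    then obtain P where "P \<subseteq> A - {v}" "P \<noteq> {}" "P \<noteq> A - {v}" "\<not> (\<exists>x\<in>P. \<exists>y\<in>A - {v} - P. E x y)"
      unfolding conn_def by blast
    then show ?thesis using that unfolding cut_def by blast
  qed
  have "A - N \<noteq> {}" using card(2,3) by (metis card.empty not_one_le_zero le_zero_eq)
  then obtain v P where vP: "cut A v P" using cuts by blast
  obtain w1 Q1 where Q1: "cut A w1 Q1" "Q1 \<subseteq> P" "Q1 \<subseteq> N"
    using cut_side_in[OF fin conn cuts vP] by blast
  obtain w2 Q2 where Q2: "cut A w2 Q2" "Q2 \<subseteq> A - {v} - P" "Q2 \<subseteq> N"
    using cut_side_in[OF fin conn cuts cut_compl[OF vP]] by blast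
  have c: "k \<le> card Q1" "k \<le> card Q2"
    using cut_card[OF fin Q1(1)] cut_card[OF fin Q2(1)] deg by blast+
  have finQ: "finite Q1" "finite Q2"
    by (rule finite_subset[OF order_trans[OF Q1(3) N] fin], rule finite_subset[OF order_trans[OF Q2(3) N] fin])
  have "card (Q1 \<union> Q2) = card Q1 + card Q2" using Q1 Q2 finQ by (intro card_Un_disjoint) auto
  moreover have "card (Q1 \<union> Q2 \<union> (A - N)) = card (Q1 \<union> Q2) + card (A - N)"
    using Q1 Q2 finQ fin by (intro card_Un_disjoint) auto
  moreover have "card (Q1 \<union> Q2 \<union> (A - N)) \<le> card A" using Q1 Q2 N fin by (intro card_mono) auto
  ultimately show False using c card by linarith
qed

text \<open>Deleting non-neighbours of \<open>y\<close> lowers the degrees as slowly as it lowers their number,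
  which reduces the statement to the situation of \<^locale>\<open>near_dominated\<close>.\<close>

lemma dominated_cycle_aux:
  assumes fin: "finite U" and y: "y \<in> U" and k3: "3 \<le> k" and Nk: "k \<le> card (nbs E U y)"
    and cU: "card U \<le> 3 * k - 2"
  shows "\<lbrakk>A \<subseteq> U - {y}; nbs E U y \<subseteq> A; conn E A; 2 * k - 1 \<le> card A;
     \<And>x. x \<in> nbs E U y \<Longrightarrow> k + j \<le> card (nbs E A x) + 1;
     \<And>x. x \<in> A - nbs E U y \<Longrightarrow> k + j \<le> card (nbs E A x);
     card (A - nbs E U y) + 1 \<le> k + j\<rbrakk> \<Longrightarrow> \<exists>cs. cyc E U cs \<and> length cs = 2 * k"
proof (induction j arbitrary: A)
  case 0
  show ?case
  proof (rule ccontr)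
    assume no: "\<not> ?thesis"
    interpret near_dominated E A "nbs E U y" k
    proof
      show "finite A" by (rule finite_subset[OF 0(1)]) (use fin in simp)
      show "\<exists>x\<in>P. \<exists>y\<in>A - P. E x y" if "P \<subseteq> A" "P \<noteq> {}" "P \<noteq> A" for P
        using 0(3) that unfolding conn_def by blast
      show "k - 1 \<le> card (nbs E A x)" if "x \<in> nbs E U y" for x using 0(5)[OF that] by simp
      show "k \<le> card (nbs E A x)" if "x \<in> A - nbs E U y" for x using 0(6)[OF that] by simp
      show "last ps \<notin> nbs E U y" if ps: "pth E A ps" "length ps = 2 * k - 1" "hd ps \<in> nbs E U y" for ps
      proof
        assume "last ps \<in> nbs E U y"
        moreover have "ps \<noteq> []" using ps k3 by auto
        moreover have "pth E U ps" "y \<notin> set ps"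
          using ps(1) 0(1) by (auto intro: pth_mono dest: pth_subset)
        ultimately have "cyc E U (ps @ [y])"
          using ps y k3 sym by (auto simp: cyc_def pth_append)
        moreover have "length (ps @ [y]) = 2 * k" using ps(2) k3 by simp
        ultimately show False using no by blast
      qed
    qed (use 0 k3 in auto)
    show False by (rule contradiction)
  qed
next
  case (Suc j)
  let ?N = "nbs E U y"
  have finA: "finite A" by (rule finite_subset[OF Suc.prems(1)]) (use fin in simp)
  show ?case
  proof (cases "card (A - ?N) + 1 \<le> k + j")
    case True
    show ?thesis
    proof (rule Suc.IH[of A])
      show "k + j \<le> card (nbs E A x) + 1" if "x \<in> ?N" for x using Suc.prems(5)[OF that] by simp
      show "k + j \<le> card (nbs E A x)" if "x \<in> A - ?N" for x using Suc.prems(6)[OF that] by simp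
    qed (use Suc.prems True in auto)
  next
    case False
    then have cN: "card (A - ?N) = k + j" using Suc.prems(7) by simp
    have "card A \<le> card (U - {y})" using Suc.prems(1) fin by (intro card_mono) auto
    then have "card A < 3 * k" using cU y fin k3 by simp
    moreover have "k \<le> card (nbs E A x)" if "x \<in> A" for x
      using Suc.prems(5)[of x] Suc.prems(6)[of x] that by (cases "x \<in> ?N") auto
    ultimately obtain v where v: "v \<in> A - ?N" "conn E (A - {v})"
      using non_cut_vertex[OF finA Suc.prems(3,2), of k] cN k3 by auto
    have drop: "card (nbs E A x) \<le> card (nbs E (A - {v}) x) + 1" for x
    proof -
      have "nbs E A x \<subseteq> insert v (nbs E (A - {v}) x)" by auto
      then have "card (nbs E A x) \<le> card (insert v (nbs E (A - {v}) x))" using finA by (intro card_mono) auto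
      also have "\<dots> \<le> Suc (card (nbs E (A - {v}) x))" by (rule card_insert_le_m1) (auto simp: finA)
      finally show ?thesis by simp
    qed
    have cN': "card (A - {v} - ?N) + 1 = k + j"
    proof -
      have "A - {v} - ?N = (A - ?N) - {v}" by auto
      then show ?thesis using v(1) cN finA k3 by (simp add: card_Diff_singleton)
    qed
    show ?thesis
    proof (rule Suc.IH[of "A - {v}"])
      show "k + j \<le> card (nbs E (A - {v}) x) + 1" if "x \<in> ?N" for x
        using Suc.prems(5)[OF that] drop[of x] by simp
      show "k + j \<le> card (nbs E (A - {v}) x)" if "x \<in> A - {v} - ?N" for x
        using Suc.prems(6)[of x] that drop[of x] by simp
      \<comment> \<open>There remain \<open>k + j - 1\<close> vertices outside the neighbourhood of
        \<open>y\<close> and at least \<open>k\<close> inside.\<close>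
      have "A - {v} = (A - {v} - ?N) \<union> ?N" using v(1) Suc.prems(2) by auto
      moreover have "card ((A - {v} - ?N) \<union> ?N) = card (A - {v} - ?N) + card ?N"
        using finA fin by (intro card_Un_disjoint) auto
      ultimately show "2 * k - 1 \<le> card (A - {v})" using cN' Nk by simp
    qed (use Suc.prems v cN' in auto)
  qed
qed

text \<open>The bound \<open>dy\<close> counts \<open>y\<close> among the vertices of
  \<open>U\<close> outside its own neighbourhood; removing it leaves at most
  \<open>k + j - 1\<close> of them, where the deletion starts.\<close>

lemma dominated_cycle:
  assumes fin: "finite U" and y: "y \<in> U" and k3: "3 \<le> k"
    and cU: "2 * k + 1 \<le> card U" "card U \<le> 3 * k - 2"
    and deg: "\<And>x. x \<in> U \<Longrightarrow> k + j \<le> card (nbs E U x)"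
    and dy: "card U \<le> card (nbs E U y) + k + j"
    and conn: "conn E (U - {y})"
  shows "\<exists>cs. cyc E U cs \<and> length cs = 2 * k"
proof (rule dominated_cycle_aux[OF fin y k3 _ cU(2), of "U - {y}" j])
  have drop: "nbs E U x \<subseteq> insert y (nbs E (U - {y}) x)" for x by auto
  show "k + j \<le> card (nbs E (U - {y}) x) + 1" if "x \<in> nbs E U y" for x
  proof -
    have "card (nbs E U x) \<le> card (insert y (nbs E (U - {y}) x))" using drop fin by (intro card_mono) auto
    also have "\<dots> \<le> Suc (card (nbs E (U - {y}) x))" by (rule card_insert_le_m1) (auto simp: fin)
    finally show ?thesis using deg[of x] that by simp
  qed
  show "k + j \<le> card (nbs E (U - {y}) x)" if "x \<in> U - {y} - nbs E U y" for x
  proof -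
    have "nbs E U x = nbs E (U - {y}) x" using that sym by auto
    then show ?thesis using deg[of x] that by simp
  qed
  have "nbs E U y \<subseteq> U - {y}" using irr by auto
  then have "card (U - {y} - nbs E U y) = card (U - {y}) - card (nbs E U y)"
    using fin by (intro card_Diff_subset) auto
  then show "card (U - {y} - nbs E U y) + 1 \<le> k + j" using dy y fin cU k3 by simp
qed (use assms irr in \<open>auto intro: order_trans[OF _ deg[OF y]]\<close>)

end

section \<open>The upper bound\<close>

lemma obtain_distinct_list:
  assumes "m \<le> card S" "finite S"
  obtains xs where "distinct xs" "set xs \<subseteq> S" "length xs = m"
  by (metis assms obtain_subset_with_card_n finite_distinct_list distinct_card)

text \<open>Blocks from one side alternate with single vertices from the other; a block with several
  vertices lets an almost alternating cycle use more vertices of its side.\<close>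

fun weave :: "'a list list \<Rightarrow> 'a list \<Rightarrow> 'a list" where
  "weave (s # ss) (r # rs) = s @ r # weave ss rs"
| "weave _ _ = []"

lemma weave:
  assumes "length ss = length rs" "distinct (concat ss @ rs)"
    "\<And>s. s \<in> set ss \<Longrightarrow> s \<noteq> [] \<and> successively E s"
    "\<And>b r. b \<in> set (concat ss) \<Longrightarrow> r \<in> set rs \<Longrightarrow> E b r \<and> E r b"
  shows "successively E (weave ss rs) \<and> distinct (weave ss rs) \<and>
    set (weave ss rs) = set (concat ss) \<union> set rs \<and>
    length (weave ss rs) = length (concat ss) + length rs \<and>
    (rs \<noteq> [] \<longrightarrow> weave ss rs \<noteq> [] \<and> hd (weave ss rs) \<in> set (concat ss) \<and> last (weave ss rs) \<in> set rs)"
  using assms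
proof (induction ss rs rule: list_induct2)
  case Nil then show ?case by simp
next
  case (Cons s ss r rs)
  have s: "s \<noteq> []" "successively E s" using Cons.prems(2)[of s] by auto
  have IH: "successively E (weave ss rs) \<and> distinct (weave ss rs) \<and>
    set (weave ss rs) = set (concat ss) \<union> set rs \<and>
    length (weave ss rs) = length (concat ss) + length rs \<and>
    (rs \<noteq> [] \<longrightarrow> weave ss rs \<noteq> [] \<and> hd (weave ss rs) \<in> set (concat ss) \<and> last (weave ss rs) \<in> set rs)"
    using Cons.prems by (intro Cons.IH) auto
  have "successively E (r # weave ss rs)"
  proof (cases "rs = []")
    case True
    then have "ss = []" using Cons.hyps by simp
    then show ?thesis using True by simp
  next
    case False
    then have "E r (hd (weave ss rs))" using IH Cons.prems(3) by auto
    then show ?thesis using IH False by (cases "weave ss rs") auto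
  qed
  moreover have "E (last s) r" using Cons.prems(3) s by auto
  ultimately have "successively E (weave (s # ss) (r # rs))"
    using s by (auto simp: successively_append_iff)
  moreover have "distinct (weave (s # ss) (r # rs))" using IH Cons.prems(1) by auto
  moreover have "last (weave (s # ss) (r # rs)) \<in> set (r # rs)"
    using IH Cons.hyps by (cases "rs = []") auto
  ultimately show ?case using IH s by auto
qed

context sgraph begin

text \<open>Handshake lemma: a new vertex \<open>a\<close> contributes its degree twice, once itself
  and once through its neighbours.\<close>

lemma even_sum_degrees:
  assumes "finite X"
  shows "even (\<Sum>x\<in>X. card (nbs E X x))"
  using assms
proof (induction X)
  case empty then show ?case by simp
next
  case (insert a X)
  have "card (nbs E (insert a X) x) = card (nbs E X x) + (if E x a then 1 else 0)" if "x \<in> X" for x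
  proof (cases "E x a")
    case True
    then have "nbs E (insert a X) x = insert a (nbs E X x)" by auto
    then show ?thesis using True insert by simp
  next
    case False
    then have "nbs E (insert a X) x = nbs E X x" by auto
    then show ?thesis using False by simp
  qed
  then have "(\<Sum>x\<in>X. card (nbs E (insert a X) x)) = (\<Sum>x\<in>X. card (nbs E X x)) + (\<Sum>x\<in>X. if E x a then 1 else 0)"
    by (simp add: sum.distrib)
  also have "(\<Sum>x\<in>X. if E x a then 1 else 0) = card (nbs E X a)"
    using insert(1) by (simp add: nbs_def sum.If_cases Int_def sym_iff[of _ a])
  finally have "(\<Sum>x\<in>X. card (nbs E (insert a X) x)) = (\<Sum>x\<in>X. card (nbs E X x)) + card (nbs E X a)" .
  moreover have "nbs E (insert a X) a = nbs E X a" using irr by auto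
  ultimately show ?case using insert by simp
qed

lemma even_card_of_regular:
  assumes "finite X" "\<And>x. x \<in> X \<Longrightarrow> card (nbs E X x) = d" "odd d"
  shows "even (card X)"
  using even_sum_degrees[OF assms(1)] assms(2,3) by simp

end

locale wheel_free = sgraph E for E :: "'a \<Rightarrow> 'a \<Rightarrow> bool" +
  fixes V U :: "'a set" and v :: 'a and n k :: nat
  assumes finV: "finite V" and k3: "3 \<le> k" and kn: "k + 1 \<le> n" "n + 2 \<le> 2 * k"
    and miss: "x \<in> V \<Longrightarrow> card (V - {x} - nbs E V x) < n"
    and v: "v \<in> V" and U: "U \<subseteq> nbs E V v" and cU: "card U = n + k"
    and cV: "card V = 2 * n + k \<or> card V + 1 = 2 * n + k \<and> even n \<and> even k"
    and wheel_free: "z \<in> V \<Longrightarrow> cyc E (nbs E V z) cs \<Longrightarrow> length cs \<noteq> 2 * k"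
begin

definition W :: "'a set" where "W = V - U"

lemma UV: "U \<subseteq> V" using U by auto

lemma fin: "finite U" "finite W" "S \<subseteq> V \<Longrightarrow> finite S"
  using finV UV finite_subset by (auto simp: W_def)

lemma WV: "W \<subseteq> V" "U \<inter> W = {}" "U \<union> W = V"
  using UV by (auto simp: W_def)

lemma vW: "v \<in> W" using v U irr by (auto simp: W_def)

lemma vU: "u \<in> U \<Longrightarrow> E v u" using U by auto

lemma cW: "card W = n \<or> card W + 1 = n \<and> even n \<and> even k"
  using cV cU card_Un_disjoint[OF fin(1,2) WV(2)] WV(3) by auto

text \<open>If \<open>card W = n - 1\<close>, both \<open>n\<close> and \<open>k\<close> are even,
  so \<open>n \<ge> k + 2\<close> makes up for the missing vertex.\<close>

lemma kW: "k + 1 \<le> card W"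
proof (cases "card W = n")
  case False
  then have "card W + 1 = n" "even n" "even k" using cW by auto
  moreover from this have "n \<noteq> k + 1" by auto
  ultimately show ?thesis using kn by simp
qed (use kn in simp)

lemma missS:
  assumes "x \<in> V" "S \<subseteq> V - {x}"
  shows "card S < card (nbs E S x) + n"
proof -
  have "S \<subseteq> nbs E S x \<union> (V - {x} - nbs E V x)" using assms by auto
  then have "card S \<le> card (nbs E S x \<union> (V - {x} - nbs E V x))"
    using assms finV finite_subset[OF assms(2)] by (intro card_mono) auto
  also have "\<dots> \<le> card (nbs E S x) + card (V - {x} - nbs E V x)" by (rule card_Un_le)
  finally show ?thesis using miss[OF assms(1)] by linarith
qed

lemma nbs_Un: "finite S \<Longrightarrow> finite T \<Longrightarrow> S \<inter> T = {} \<Longrightarrow>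
    card (nbs E (S \<union> T) x) = card (nbs E S x) + card (nbs E T x)"
  by (subst card_Un_disjoint[symmetric]) (auto intro!: arg_cong[where f = card])

lemma no_bipartite:
  assumes "z \<in> V" "X \<subseteq> nbs E V z" "Y \<subseteq> nbs E V z" "X \<inter> Y = {}" "k \<le> card X" "card Y \<le> 2 * k - 2"
  shows "\<exists>x\<in>X. card (nbs E Y x) < k"
proof (rule ccontr)
  assume "\<not> ?thesis"
  then have deg: "k \<le> card (nbs E Y x)" if "x \<in> X" for x using that by force
  obtain X' where X': "X' \<subseteq> X" "card X' = k" "finite X'"
    using assms(5) by (metis obtain_subset_with_card_n)
  have "X' \<union> Y \<subseteq> nbs E V z" using X' assms by auto
  moreover have "finite Y" using assms(3) fin(3) nbs_subset by (metis order_trans)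
  then have "\<exists>cs. cyc E (X' \<union> Y) cs \<and> length cs = 2 * k"
    using X' assms(4,6) deg k3 by (intro bipartite_cycle) auto
  then obtain cs where "cyc E (X' \<union> Y) cs" "length cs = 2 * k" by blast
  ultimately show False using wheel_free[OF assms(1)] cyc_mono by blast
qed

lemma degU:
  assumes "x \<in> U"
  shows "k + card W \<le> card (nbs E U x) + card (nbs E W x)"
proof -
  have x: "x \<in> V" "x \<notin> W" using assms UV WV by auto
  have "card ((U - {x}) \<union> W) < card (nbs E ((U - {x}) \<union> W) x) + n"
    using x UV WV by (intro missS) auto
  moreover have "card ((U - {x}) \<union> W) = card (U - {x}) + card W"
    using fin WV by (intro card_Un_disjoint) auto
  moreover have "card (nbs E ((U - {x}) \<union> W) x) = card (nbs E (U - {x}) x) + card (nbs E W x)"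
    using fin WV by (intro nbs_Un) auto
  moreover have "nbs E (U - {x}) x = nbs E U x" using irr by auto
  ultimately show ?thesis using cU assms fin by simp
qed

lemma degU': "x \<in> U \<Longrightarrow> k \<le> card (nbs E U x)"
  using degU[of x] card_mono[OF fin(2) nbs_subset[of E W x]] by simp

text \<open>A set \<open>B\<close> completely joined to a set of \<open>k - 1\<close> vertices, all adjacent to the hub \<open>z\<close>, contains at
  most one edge: two edges in \<open>B\<close> would balance the two sides of an almost alternating cycle.\<close>

lemma two_edges:
  assumes z: "z \<in> V" and R: "R \<subseteq> nbs E V z" "card R = k - 1" and B: "B \<subseteq> nbs E V z" "R \<inter> B = {}"
    and cB: "k + 2 \<le> card B" and join: "\<And>b r. b \<in> B \<Longrightarrow> r \<in> R \<Longrightarrow> E b r"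
    and e: "a \<in> B" "b \<in> B" "E a b" "c \<in> B" "d \<in> B" "E c d" "{a, b} \<noteq> {c, d}"
  shows False
proof -
  have finB: "finite B" "finite R" using B R fin(3) nbs_subset by (metis order_trans)+
  \<comment> \<open>\<open>ss\<close> holds the blocks with an edge inside; they have two vertices
    more than there are blocks. Filled up with single vertices to \<open>k - 1\<close> blocks they
    use \<open>k + 1\<close> vertices of \<open>B\<close>, and with \<open>R\<close> in between the
    length is \<open>2 * k\<close>.\<close>
  have main: False if ss: "length ss \<le> k - 1" "length (concat ss) = length ss + 2"
    "set (concat ss) \<subseteq> B" "distinct (concat ss)"
    "\<And>s. s \<in> set ss \<Longrightarrow> s \<noteq> [] \<and> successively E s" for ss
  proof -
    have cc: "card (set (concat ss)) = length ss + 2" using ss(2,4) distinct_card by metis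
    have "k - 1 - length ss \<le> card (B - set (concat ss))"
      using cB ss(1,3) cc finB by (simp add: card_Diff_subset del: set_concat)
    then obtain ws where ws: "distinct ws" "set ws \<subseteq> B - set (concat ss)" "length ws = k - 1 - length ss"
      using finB obtain_distinct_list[of _ "B - set (concat ss)"] by blast
    obtain rs where rs: "distinct rs" "set rs = R" "length rs = k - 1"
      using finite_distinct_list[OF finB(2)] R(2) distinct_card by metis
    define ts where "ts = ss @ map (\<lambda>w. [w]) ws"
    have cts: "concat ts = concat ss @ ws" by (simp add: ts_def)
    have tB: "set (concat ts) \<subseteq> B" unfolding cts using ss(3) ws(2) by auto
    have "length ts = length rs" using ws ss(1) rs by (simp add: ts_def)
    moreover have "distinct (concat ts @ rs)" unfolding cts using ss ws rs B(2) by (auto simp del: set_concat)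
    moreover have "s \<noteq> [] \<and> successively E s" if "s \<in> set ts" for s using that ss(5) by (auto simp: ts_def)
    moreover have "E b r \<and> E r b" if "b \<in> set (concat ts)" "r \<in> set rs" for b r
      using that tB rs(2) join sym by blast
    ultimately have w: "successively E (weave ts rs) \<and> distinct (weave ts rs) \<and>
      set (weave ts rs) = set (concat ts) \<union> set rs \<and>
      length (weave ts rs) = length (concat ts) + length rs \<and>
      (rs \<noteq> [] \<longrightarrow> weave ts rs \<noteq> [] \<and> hd (weave ts rs) \<in> set (concat ts) \<and> last (weave ts rs) \<in> set rs)"
      by (rule weave)
    have "rs \<noteq> []" using rs k3 by auto
    then have "E (last (weave ts rs)) (hd (weave ts rs))" using w tB rs(2) join sym by blast
    moreover have len: "length (weave ts rs) = 2 * k" using w cts ss(1,2) ws rs k3 by simp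
    moreover have "set (weave ts rs) \<subseteq> nbs E V z" using w tB rs(2) R(1) B(1) by blast
    ultimately have "cyc E (nbs E V z) (weave ts rs)" using w k3 by (simp add: cyc_def pth_def)
    then show False using wheel_free[OF z] len by blast
  qed
  have ab: "a \<noteq> b" "c \<noteq> d" using e irr by auto
  have P3: False if "x \<in> B" "y \<in> B" "w \<in> B" "E x y" "E y w" "x \<noteq> w" for x y w
    using that k3 irr by (intro main[of "[[x, y, w]]"]) auto
  consider "a = c" | "a = d" | "b = c" | "b = d" | "{a, b} \<inter> {c, d} = {}" by auto
  then show False
  proof cases
    case 1 then show False using P3[of b a d] e sym by auto
  next
    case 2 then show False using P3[of b a c] e sym by auto
  next
    case 3 then show False using P3[of a b d] e sym by auto
  next
    case 4 then show False using P3[of a b c] e sym by auto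
  next
    case 5
    show False using 5 e ab k3 by (intro main[of "[[a, b], [c, d]]"]) auto
  qed
qed

text \<open>Vertices of the smaller part \<open>X1\<close> already miss all of \<open>X2\<close>, so
  they miss little else. Either one of them has \<open>k\<close> neighbours in \<open>X1\<close> and
  serves as hub for a bipartite cycle, or \<open>X1\<close> is \<open>(k - 1)\<close>-regular and
  completely joined to \<open>W\<close> and \<open>y\<close>, where \<open>two_edges\<close>
  applies.\<close>

lemma no_split:
  assumes y: "y \<in> U" and part: "X1 \<union> X2 = U - {y}" "X1 \<inter> X2 = {}" "X1 \<noteq> {}" "X2 \<noteq> {}"
    and sep: "\<And>x z. x \<in> X1 \<Longrightarrow> z \<in> X2 \<Longrightarrow> \<not> E x z" and le: "card X1 \<le> card X2"
  shows False
proof -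
  define a1 a2 w where "a1 = card X1" and "a2 = card X2" and "w = card W"
  have sub: "X1 \<subseteq> U" "X2 \<subseteq> U" "X1 \<subseteq> V" "X2 \<subseteq> V" "y \<notin> X1" "y \<notin> X2" "y \<notin> W" "X1 \<inter> W = {}" "X2 \<inter> W = {}" "y \<in> V"
    using part UV y WV by auto
  have finX: "finite X1" "finite X2" using sub fin(3) by auto
  have a12: "a1 + a2 + 1 = n + k"
    using card_Un_disjoint[OF finX part(2)] part(1) cU y fin kn unfolding a1_def a2_def by simp
  \<comment> \<open>\<open>2 * a1 + 1 \<le> n + k\<close> holds in any case; if
    \<open>card W = n - 1\<close>, the right side is even and the left odd, which yields the missing
    unit.\<close>
  have w2: "2 * a1 + 1 \<le> w + k"
  proof (cases "card W = n")
    case False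
    then have "w + 1 = n" "even n" "even k" using cW by (auto simp: w_def)
    then have "2 * a1 + 1 \<noteq> n + k" by presburger
    then show ?thesis using a12 le \<open>w + 1 = n\<close> unfolding a1_def a2_def by linarith
  qed (use a12 le in \<open>simp add: a1_def a2_def w_def\<close>)
  have wk: "k + 1 \<le> w" "w \<le> n" using kW cW by (auto simp: w_def)
  have split: "card (nbs E U x) \<le> card (nbs E X x) + (if E x y then 1 else 0)"
    if x: "x \<in> X" "X = X1 \<and> X' = X2 \<or> X = X2 \<and> X' = X1" for x X X'
  proof -
    have "nbs E U x \<subseteq> nbs E X x \<union> (if E x y then {y} else {})"
    proof
      fix z assume z: "z \<in> nbs E U x"
      show "z \<in> nbs E X x \<union> (if E x y then {y} else {})"
      proof (cases "z = y")
        case False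
        then have "z \<in> X \<union> X'" using z part(1) x(2) by auto
        moreover have "z \<notin> X'" using z x sep sym by (metis in_nbs)
        ultimately show ?thesis using z by auto
      qed (use z in auto)
    qed
    then have "card (nbs E U x) \<le> card (nbs E X x \<union> (if E x y then {y} else {}))"
      using x finX by (intro card_mono) auto
    also have "\<dots> \<le> card (nbs E X x) + card (if E x y then {y} else {})" by (rule card_Un_le)
    finally show ?thesis by (auto split: if_splits)
  qed
  \<comment> \<open>A vertex of \<open>X1\<close> misses the \<open>a2 = n + k - 1 - a1\<close>
    vertices of \<open>X2\<close>, hence at most \<open>a1 - k\<close> others.\<close>
  have miss1: "card S + k \<le> card (nbs E S x) + a1" if x: "x \<in> X1" and S: "S \<subseteq> V - {x} - X2" for x S
  proof -
    have "card (S \<union> X2) < card (nbs E (S \<union> X2) x) + n"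
      using x S sub part(2) by (intro missS) auto
    moreover have "card (S \<union> X2) = card S + a2"
      unfolding a2_def using S finX fin(3)[of S] by (intro card_Un_disjoint) auto
    moreover have "nbs E (S \<union> X2) x = nbs E S x" using sep x by auto
    ultimately show ?thesis using a12 by simp
  qed
  show False
  proof (cases "\<exists>x\<in>X1. k \<le> card (nbs E X1 x)")
    case True
    then obtain x where x: "x \<in> X1" "k \<le> card (nbs E X1 x)" by blast
    then obtain X where X: "X \<subseteq> nbs E X1 x" "card X = k" "finite X" by (metis obtain_subset_with_card_n)
    \<comment> \<open>Hub \<open>x\<close>: the sides are \<open>X\<close> and \<open>w - 1\<close>
      further neighbours \<open>Y\<close> in \<open>X1 \<union> W\<close>. A vertex of
      \<open>X\<close> misses at most \<open>a1 - k\<close> of \<open>Y\<close>, and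
      \<open>a1 \<le> w - 1\<close> leaves it \<open>k\<close> neighbours there.\<close>
    define S where "S = X1 \<union> W - insert x X"
    have "x \<notin> X" using X irr by auto
    then have "card (insert x X) = k + 1" using X by simp
    moreover have "insert x X \<subseteq> X1 \<union> W" using x X by auto
    moreover from this have "card (insert x X) \<le> card (X1 \<union> W)" using fin finX by (intro card_mono) auto
    ultimately have "card S + k + 1 = card (X1 \<union> W)"
      unfolding S_def using X by (subst card_Diff_subset) auto
    moreover have "card (X1 \<union> W) = a1 + w"
      unfolding a1_def w_def using finX fin sub by (intro card_Un_disjoint) auto
    ultimately have cS: "card S + k + 1 = a1 + w" by simp
    have "card S + k \<le> card (nbs E S x) + a1"
      using x(1) sub part WV by (intro miss1) (auto simp: S_def)
    then have "w - 1 \<le> card (nbs E S x)" using cS wk by linarith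
    then obtain Y where Y: "Y \<subseteq> nbs E S x" "card Y = w - 1" by (metis obtain_subset_with_card_n)
    have "\<exists>z\<in>X. card (nbs E Y z) < k"
    proof (rule no_bipartite[of x])
      show "x \<in> V" using x sub by auto
      show "X \<subseteq> nbs E V x" using X(1) nbs_mono[OF sub(3), of E x] by (rule order_trans)
      have "S \<subseteq> V" using sub WV by (auto simp: S_def)
      then show "Y \<subseteq> nbs E V x" by (rule order_trans[OF Y(1) nbs_mono])
      have "Y \<subseteq> S" by (rule order_trans[OF Y(1) nbs_subset])
      then show "X \<inter> Y = {}" by (auto simp: S_def)
      show "card Y \<le> 2 * k - 2" using Y wk kn by simp
    qed (use X in simp)
    then obtain z where z: "z \<in> X" "card (nbs E Y z) < k" by blast
    have "card Y + k \<le> card (nbs E Y z) + a1"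
    proof (rule miss1)
      show "z \<in> X1" using z(1) X(1) by auto
      have "S \<subseteq> V - {z} - X2" using z(1) part(2) sub WV by (auto simp: S_def)
      then show "Y \<subseteq> V - {z} - X2" by (rule order_trans[OF order_trans[OF Y(1) nbs_subset]])
    qed
    then show False using z(2) Y(2) w2 wk by linarith
  next
    case False
    have reg: "card (nbs E X1 x) = k - 1" "E x y" if "x \<in> X1" for x
    proof -
      have "\<not> k \<le> card (nbs E X1 x)" using False that by blast
      moreover have "k \<le> card (nbs E U x)" using degU' that sub by auto
      ultimately show "card (nbs E X1 x) = k - 1" "E x y"
        using split[of x X1 X2] that by (auto split: if_splits)
    qed
    \<comment> \<open>With only \<open>k - 1\<close> neighbours in \<open>X1\<close>,
      \<open>x\<close> misses \<open>a1 - k\<close> vertices there, all that \<open>miss1\<close>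
      allows.\<close>
    have full: "E x b" if x: "x \<in> X1" and b: "b \<in> W" for x b
    proof -
      have "card ((X1 - {x}) \<union> W) + k \<le> card (nbs E ((X1 - {x}) \<union> W) x) + a1"
        using x sub part(2) WV by (intro miss1) auto
      moreover have "card ((X1 - {x}) \<union> W) = card (X1 - {x}) + w"
        unfolding w_def using finX fin sub by (intro card_Un_disjoint) auto
      moreover have "card (nbs E ((X1 - {x}) \<union> W) x) = card (nbs E (X1 - {x}) x) + card (nbs E W x)"
        using finX fin sub by (intro nbs_Un) auto
      moreover have "nbs E (X1 - {x}) x = nbs E X1 x" using irr by auto
      moreover have "card (X1 - {x}) + 1 = a1" using x finX unfolding a1_def
        by (metis Suc_eq_plus1 card_Suc_Diff1)
      ultimately have "w \<le> card (nbs E W x)" using reg(1)[OF x] k3 by simp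
      then have "nbs E W x = W" using fin(2) nbs_subset unfolding w_def by (metis card_seteq)
      then show ?thesis using b by (metis in_nbs)
    qed
    define B where "B = insert y W"
    have B: "B \<subseteq> V" "card B = w + 1" using sub WV fin by (auto simp: B_def w_def)
    obtain x where x: "x \<in> X1" using part by auto
    have joinB: "E b r" if "b \<in> B" "r \<in> X1" for b r using that reg(2) full sym by (auto simp: B_def)
    have edges: False if "a \<in> B" "b \<in> B" "E a b" "c \<in> B" "d \<in> B" "E c d" "{a, b} \<noteq> {c, d}" for a b c d
    proof (rule two_edges[of x "nbs E X1 x" B a b c d])
      show "x \<in> V" using x sub by auto
      show "nbs E X1 x \<subseteq> nbs E V x" using sub by auto
      show "card (nbs E X1 x) = k - 1" by (rule reg(1)[OF x])
      show "B \<subseteq> nbs E V x" using B joinB x sym by auto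
      show "nbs E X1 x \<inter> B = {}" using sub by (auto simp: B_def)
      show "k + 2 \<le> card B" using B wk by simp
      show "E b r" if "b \<in> B" "r \<in> nbs E X1 x" for b r using joinB that by auto
    qed (use that in auto)
    \<comment> \<open>This is the one edge that \<open>two_edges\<close> tolerates in
      \<open>B\<close>.\<close>
    have vy: "v \<in> B" "y \<in> B" "E v y" using vW vU y by (auto simp: B_def)
    have only: "{c, d} = {v, y}" if "c \<in> B" "d \<in> B" "E c d" for c d
      using edges[OF vy that] by auto
    have isolated: "nbs E B z = {}" if "z \<in> B - {v, y}" for z
      using only[of z] that by (auto simp: doubleton_eq_iff)
    have B3: "\<exists>z. z \<in> B - {v, y}"
    proof -
      have "\<not> B \<subseteq> {v, y}" using card_mono[of "{v, y}" B] B(2) wk k3 card_insert_le_m1[of 2 "{y}" v]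
        by (auto simp: card_insert_if split: if_splits)
      then show ?thesis by blast
    qed
    show False
    proof (cases "w = n")
      case True
      obtain z where z: "z \<in> B - {v, y}" using B3 by blast
      have "card (B - {z}) < card (nbs E (B - {z}) z) + n" using z B by (intro missS) auto
      moreover have "nbs E (B - {z}) z = {}" using isolated[OF z] by auto
      moreover have "card (B - {z}) = w" using z B finV finite_subset[OF B(1)] by simp
      ultimately show False using True by simp
    next
      case False
      then have par: "w + 1 = n" "even n" "even k" using cW by (auto simp: w_def)
      \<comment> \<open>For \<open>b \<noteq> v\<close> the other \<open>n - 1\<close> vertices of
        \<open>B\<close> are all missed by \<open>b\<close>, so none of \<open>X2\<close> can
        be.\<close>
      have full2: "E u b" if u: "u \<in> X2" and b: "b \<in> W" for u b
      proof (cases "b = v")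
        case True then show ?thesis using vU sub u sym by auto
      next
        case False
        then have bB: "b \<in> B - {v, y}" using b sub by (auto simp: B_def)
        have uB: "u \<notin> B" "u \<noteq> b" using u b sub by (auto simp: B_def)
        have "card (insert u (B - {b})) < card (nbs E (insert u (B - {b})) b) + n"
          using uB u sub bB B by (intro missS) auto
        moreover have "card (insert u (B - {b})) = n"
          using uB bB B par finV finite_subset[OF B(1)] by simp
        ultimately have "nbs E (insert u (B - {b})) b \<noteq> {}" by auto
        then obtain c where "c \<in> nbs E (insert u (B - {b})) b" by blast
        then have c: "c \<in> insert u (B - {b})" "E b c" by simp_all
        moreover have "c \<notin> B" using isolated[OF bB] c(2) by (metis empty_iff in_nbs)
        ultimately show ?thesis using sym by auto
      qed
      \<comment> \<open>A vertex with \<open>k\<close> neighbours in \<open>X2\<close> would be a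
        hub, as \<open>X2\<close> is completely joined to \<open>W\<close>.\<close>
      have reg2: "card (nbs E X2 u) = k - 1" if u: "u \<in> X2" for u
      proof -
        have "\<not> k \<le> card (nbs E X2 u)"
        proof
          assume kc: "k \<le> card (nbs E X2 u)"
          have "\<exists>z\<in>nbs E X2 u. card (nbs E W z) < k"
          proof (rule no_bipartite[of u])
            show "W \<subseteq> nbs E V u" using full2[OF u] WV by auto
            show "card W \<le> 2 * k - 2" using wk kn by (simp add: w_def)
          qed (use u sub kc in auto)
          then obtain z where z: "z \<in> X2" "card (nbs E W z) < k" by auto
          have "nbs E W z = W" using full2[OF z(1)] by auto
          then show False using z(2) wk by (simp add: w_def)
        qed
        moreover have "k \<le> card (nbs E U u)" using degU' u sub by auto
        ultimately show ?thesis using split[of u X2 X1] u by (auto split: if_splits)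
      qed
      \<comment> \<open>Both parts are regular of odd degree, hence of even order, while
        \<open>a1 + a2 + 1 = n + k\<close> is even.\<close>
      have "odd (k - 1)" using par k3 by simp
      then have "even a1" "even a2"
        using even_card_of_regular[OF finX(1) reg(1)] even_card_of_regular[OF finX(2) reg2]
        by (auto simp: a1_def a2_def)
      then show False using a12 par by (metis even_add odd_one)
    qed
  qed
qed

lemma contradiction: False
proof -
  have "U \<noteq> {}" using cU k3 by auto
  then obtain x where x: "x \<in> U" "\<And>z. z \<in> U \<Longrightarrow> card (nbs E W z) \<le> card (nbs E W x)"
    using ex_has_greatest_nat[of "\<lambda>z. z \<in> U" _ "\<lambda>z. card (nbs E W z)" "card W + 1"]
      card_mono[OF fin(2) nbs_subset] by (metis ex_in_conv less_Suc_eq_le Suc_eq_plus1)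
  \<comment> \<open>Every vertex of \<open>U\<close> misses at least \<open>j\<close> vertices of
    \<open>W\<close>, which raises the minimum degree in \<open>U\<close> to
    \<open>k + j\<close>.\<close>
  define j where "j = card W - card (nbs E W x)"
  have j: "card W = card (nbs E W x) + j"
    using card_mono[OF fin(2) nbs_subset[of E W x]] by (simp add: j_def)
  have deg: "k + j \<le> card (nbs E U z)" if "z \<in> U" for z
    using degU[OF that] x(2)[OF that] j by linarith
  have wn: "card W \<le> n" "n \<le> card W + 1" using cW by auto
  have "\<exists>y\<in>nbs E U x. card (nbs E (nbs E W x) y) < k"
  proof (rule no_bipartite[of x])
    show "x \<in> V" using x UV by auto
    show "nbs E U x \<subseteq> nbs E V x" "nbs E W x \<subseteq> nbs E V x" using UV WV by auto
    show "nbs E U x \<inter> nbs E W x = {}" using WV by auto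
    show "k \<le> card (nbs E U x)" using deg[OF x(1)] by simp
    show "card (nbs E W x) \<le> 2 * k - 2" using j wn kn by linarith
  qed
  then obtain y where y: "y \<in> U" "card (nbs E (nbs E W x) y) < k" by auto
  \<comment> \<open>Besides fewer than \<open>k\<close> neighbours shared with \<open>x\<close>,
    only the \<open>j\<close> vertices of \<open>W\<close> not adjacent to \<open>x\<close> are left
    for \<open>y\<close>.\<close>
  have "nbs E W y \<subseteq> nbs E (nbs E W x) y \<union> (W - nbs E W x)" by auto
  then have "card (nbs E W y) \<le> card (nbs E (nbs E W x) y \<union> (W - nbs E W x))"
    using fin by (intro card_mono) auto
  also have "\<dots> \<le> card (nbs E (nbs E W x) y) + card (W - nbs E W x)" by (rule card_Un_le)
  also have "card (W - nbs E W x) = j"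
    unfolding j_def using fin by (intro card_Diff_subset) auto
  finally have "card W + 1 \<le> card (nbs E U y) + j" using y(2) degU[OF y(1)] by linarith
  then have dy: "card U \<le> card (nbs E U y) + k + j" using cU wn by linarith
  have "\<not> conn E (U - {y})"
  proof
    assume c: "conn E (U - {y})"
    have "2 * k + 1 \<le> card U" "card U \<le> 3 * k - 2" using cU kn by linarith+
    then obtain cs where "cyc E U cs" "length cs = 2 * k"
      using dominated_cycle[OF fin(1) y(1) k3 _ _ deg dy c] by blast
    then show False using wheel_free[OF v] cyc_mono[OF _ U] by blast
  qed
  then obtain P where P: "P \<subseteq> U - {y}" "P \<noteq> {}" "P \<noteq> U - {y}" "\<And>x z. x \<in> P \<Longrightarrow> z \<in> U - {y} - P \<Longrightarrow> \<not> E x z"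
    unfolding conn_def by blast
  show False
  proof (cases "card P \<le> card (U - {y} - P)")
    case True
    show False by (rule no_split[OF y(1) _ _ _ _ P(4) True]) (use P in auto)
  next
    case False
    then have "card (U - {y} - P) \<le> card P" by simp
    then show False by (rule no_split[OF y(1), of "U - {y} - P" P, rotated 5]) (use P sym in blast)+
  qed
qed

end

section \<open>Copies of stars and wheels, and the lower bound\<close>

definition adj :: "'a graph \<Rightarrow> 'a \<Rightarrow> 'a \<Rightarrow> bool" where
  "adj G x y \<longleftrightarrow> {x, y} \<in> edges G"

lemma adj_sgraph: "simple_graph G \<Longrightarrow> sgraph (adj G)"
  by unfold_locales (auto simp: adj_def simple_graph_def nsets_def insert_commute)

lemma doubleton_nsets_2: "{x, y} \<in> nsets V 2 \<longleftrightarrow> x \<in> V \<and> y \<in> V \<and> x \<noteq> y"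
  by (auto simp: nsets_def card_insert_if)

lemma adj_complement:
  "adj (complement G) x y \<longleftrightarrow> x \<in> verts G \<and> y \<in> verts G \<and> x \<noteq> y \<and> \<not> adj G x y"
  by (auto simp: adj_def complement_def doubleton_nsets_2)

lemma contains_copy_iff:
  assumes H: "simple_graph H"
  shows "contains_copy G H \<longleftrightarrow>
    (\<exists>g. inj_on g (verts H) \<and> g ` verts H \<subseteq> verts G \<and> (\<forall>e\<in>edges H. g ` e \<in> edges G))"
proof
  assume "contains_copy G H"
  then obtain S f where S: "subgraph S G" and f: "bij_betw f (verts S) (verts H)"
    and ed: "edges H = (\<lambda>e. f ` e) ` edges S"
    unfolding contains_copy_def isomorphic_def by blast
  define g where "g = inv_into (verts S) f"
  have g: "bij_betw g (verts H) (verts S)" unfolding g_def by (rule bij_betw_inv_into[OF f])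
  have "g ` (f ` e) \<in> edges G" if e: "e \<in> edges S" for e
  proof -
    have "e \<subseteq> verts S" using S e by (auto simp: subgraph_def simple_graph_def nsets_def)
    then have "g ` (f ` e) = e"
      unfolding g_def using f by (simp add: bij_betw_def inv_into_image_cancel)
    then show ?thesis using S e by (auto simp: subgraph_def)
  qed
  then show "\<exists>g. inj_on g (verts H) \<and> g ` verts H \<subseteq> verts G \<and> (\<forall>e\<in>edges H. g ` e \<in> edges G)"
    using g S ed by (intro exI[of _ g]) (auto simp: bij_betw_def subgraph_def)
next
  assume "\<exists>g. inj_on g (verts H) \<and> g ` verts H \<subseteq> verts G \<and> (\<forall>e\<in>edges H. g ` e \<in> edges G)"
  then obtain g where g: "inj_on g (verts H)" "g ` verts H \<subseteq> verts G" "\<forall>e\<in>edges H. g ` e \<in> edges G"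
    by blast
  define S where "S = \<lparr>verts = g ` verts H, edges = (\<lambda>e. g ` e) ` edges H\<rparr>"
  have eH: "e \<subseteq> verts H" "finite e" "card e = 2" if "e \<in> edges H" for e
    using H that by (auto simp: simple_graph_def nsets_def)
  have "g ` e \<in> nsets (verts S) 2" if "e \<in> edges H" for e
    using eH[OF that] inj_on_subset[OF g(1) eH(1)[OF that]]
    by (auto simp: nsets_def card_image S_def)
  moreover have "finite (verts S)" using H by (simp add: S_def simple_graph_def)
  ultimately have "subgraph S G"
    using g by (auto simp: subgraph_def simple_graph_def S_def)
  moreover have "isomorphic S H"
    unfolding isomorphic_def
  proof (intro exI conjI)
    have bg: "bij_betw g (verts H) (verts S)" using g(1) by (simp add: bij_betw_def S_def)
    show "bij_betw (inv_into (verts H) g) (verts S) (verts H)" by (rule bij_betw_inv_into[OF bg])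
    have "inv_into (verts H) g ` (g ` e) = e" if "e \<in> edges H" for e
      using eH[OF that] g(1) by (simp add: inv_into_image_cancel)
    then show "edges H = (\<lambda>e. inv_into (verts H) g ` e) ` edges S"
      by (simp add: S_def image_image)
  qed
  ultimately show "contains_copy G H" unfolding contains_copy_def by blast
qed

lemma contains_star:
  assumes G: "simple_graph G"
  shows "contains_copy G (star n) \<longleftrightarrow> (\<exists>z\<in>verts G. n \<le> card (nbs (adj G) (verts G) z))"
proof
  assume "contains_copy G (star n)"
  then obtain g where g: "inj_on g {0..n}" "g ` {0..n} \<subseteq> verts G" "\<forall>e\<in>edges (star n). g ` e \<in> edges G"
    unfolding contains_copy_iff[OF simple_graph_star] by (auto simp: star_def)
  have "g ` {1..n} \<subseteq> nbs (adj G) (verts G) (g 0)"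
  proof
    fix y assume "y \<in> g ` {1..n}"
    then obtain i where i: "i \<in> {1..n}" "y = g i" by blast
    then have "{0, i} \<in> edges (star n)" by (auto simp: star_def)
    then have "g ` {0, i} \<in> edges G" using g(3) by blast
    then show "y \<in> nbs (adj G) (verts G) (g 0)" using i g(2) by (auto simp: adj_def)
  qed
  moreover have "finite (verts G)" using G by (simp add: simple_graph_def)
  ultimately have "card (g ` {1..n}) \<le> card (nbs (adj G) (verts G) (g 0))" by (intro card_mono) auto
  moreover have "inj_on g {1..n}" by (rule inj_on_subset[OF g(1)]) auto
  then have "card (g ` {1..n}) = n" by (simp add: card_image)
  moreover have "g 0 \<in> verts G" using g(2) by auto
  ultimately show "\<exists>z\<in>verts G. n \<le> card (nbs (adj G) (verts G) z)" by auto
next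
  assume "\<exists>z\<in>verts G. n \<le> card (nbs (adj G) (verts G) z)"
  then obtain z T where z: "z \<in> verts G" and T: "T \<subseteq> nbs (adj G) (verts G) z" "card T = n" "finite T"
    by (metis obtain_subset_with_card_n)
  obtain h where h: "bij_betw h {1..n} T" using ex_bij_betw_nat_finite_1[OF T(3)] T(2) by auto
  define g where "g i = (if i = 0 then z else h i)" for i
  have hT: "h i \<in> nbs (adj G) (verts G) z" if "i \<in> {1..n}" for i
    using bij_betwE[OF h] that T(1) by blast
  have "z \<notin> T" using T(1) sgraph.irr[OF adj_sgraph[OF G]] by auto
  moreover have gh: "g i = h i" if "i \<in> {1..n}" for i using that by (auto simp: g_def)
  then have "inj_on g {1..n}" "g ` {1..n} = T"
    using h inj_on_cong[of "{1..n}" g h] image_cong[of "{1..n}" "{1..n}" g h] by (simp_all add: bij_betw_def)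
  moreover have g0: "g 0 = z" by (simp add: g_def)
  moreover have n0: "{0..n} = insert 0 {1..n}" by auto
  ultimately have "inj_on g {0..n}" by simp
  moreover have "g ` {0..n} \<subseteq> verts G" using z hT gh g0 unfolding n0 by auto
  moreover have "g ` {0, i} \<in> edges G" if "i \<in> {1..n}" for i 
    using hT[OF that] gh[OF that] g0 by (simp add: adj_def)
  ultimately show "contains_copy G (star n)"
    unfolding contains_copy_iff[OF simple_graph_star]
    by (intro exI[of _ g]) (auto simp: star_def simp del: image_insert)
qed

lemma contains_wheel:
  assumes G: "simple_graph G" and m: "3 \<le> m"
  shows "contains_copy G (wheel m) \<longleftrightarrow>
    (\<exists>z\<in>verts G. \<exists>cs. cyc (adj G) (nbs (adj G) (verts G) z) cs \<and> length cs = m)"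
proof -
  have vm: "verts (wheel m) = {..m}" by (auto simp: wheel_def cycle_def)
  show ?thesis
proof
  assume "contains_copy G (wheel m)"
  then obtain g where g: "inj_on g {..m}" "g ` {..m} \<subseteq> verts G"
    and e: "\<And>e. e \<in> edges (wheel m) \<Longrightarrow> g ` e \<in> edges G"
    unfolding contains_copy_iff[OF simple_graph_wheel[OF m]] vm by blast
  have rim: "adj G (g i) (g (Suc i mod m))" if "i < m" for i
  proof -
    have "{i, Suc i mod m} \<in> edges (wheel m)" using that by (auto simp: wheel_def cycle_def)
    then show ?thesis using e[of "{i, Suc i mod m}"] by (simp add: adj_def)
  qed
  have spoke: "adj G (g m) (g i)" if "i < m" for i
  proof -
    have "{m, i} \<in> edges (wheel m)" using that by (auto simp: wheel_def cycle_def)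
    then show ?thesis using e[of "{m, i}"] by (simp add: adj_def)
  qed
  define cs where "cs = map g [0..<m]"
  have "inj_on g {0..<m}" by (rule inj_on_subset[OF g(1)]) auto
  then have "distinct cs" by (simp add: cs_def distinct_map)
  moreover have "set cs \<subseteq> nbs (adj G) (verts G) (g m)" using g(2) spoke by (auto simp: cs_def image_subset_iff)
  moreover have "adj G (cs ! i) (cs ! Suc i)" if "Suc i < m" for i
    using rim[of i] that by (simp add: cs_def)
  then have "successively (adj G) cs" by (auto simp: successively_conv_nth cs_def)
  moreover have "adj G (last cs) (hd cs)"
    using rim[of "m - 1"] m by (simp add: cs_def last_map hd_map last_conv_nth)
  ultimately have "cyc (adj G) (nbs (adj G) (verts G) (g m)) cs" "length cs = m"
    using m by (auto simp: cyc_def pth_def cs_def)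
  then show "\<exists>z\<in>verts G. \<exists>cs. cyc (adj G) (nbs (adj G) (verts G) z) cs \<and> length cs = m"
    using g(2) by blast
next
  assume "\<exists>z\<in>verts G. \<exists>cs. cyc (adj G) (nbs (adj G) (verts G) z) cs \<and> length cs = m"
  then obtain z cs where z: "z \<in> verts G" and cs: "cyc (adj G) (nbs (adj G) (verts G) z) cs"
    and len: "length cs = m" by blast
  define g where "g i = (if i = m then z else cs ! i)" for i
  have d: "distinct cs" "set cs \<subseteq> nbs (adj G) (verts G) z" using cs by (auto simp: cyc_def pth_def)
  have mem: "cs ! i \<in> nbs (adj G) (verts G) z" if "i < m" for i
    using d(2) nth_mem[of i cs] len that by blast
  have zc: "cs ! i \<noteq> z" if "i < m" for i using mem[OF that] sgraph.irr[OF adj_sgraph[OF G]] by auto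
  have "inj_on (\<lambda>i. cs ! i) {..<m}" using d(1) len by (intro inj_on_nth) auto
  moreover have "g i = cs ! i" if "i \<in> {..<m}" for i using that by (simp add: g_def)
  ultimately have "inj_on g {..<m}" using inj_on_cong[of "{..<m}" g "\<lambda>i. cs ! i"] by simp
  moreover have "g m \<notin> g ` {..<m}" using zc by (auto simp: g_def)
  moreover have "{..m} = insert m {..<m}" by auto
  ultimately have "inj_on g {..m}" by simp
  moreover have "g ` {..m} \<subseteq> verts G" using z mem by (auto simp: g_def)
  moreover have "{g i, g (Suc i mod m)} \<in> edges G" if "i < m" for i
  proof -
    have "Suc i mod m \<noteq> m" using mod_less_divisor[of m "Suc i"] m by linarith
    then show ?thesis using cyc_nth_Suc[OF cs, of i] that len by (simp add: g_def adj_def)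
  qed
  moreover have "{g m, g i} \<in> edges G" if "i < m" for i
    using mem[OF that] that by (simp add: g_def adj_def)
  ultimately show "contains_copy G (wheel m)"
    unfolding contains_copy_iff[OF simple_graph_wheel[OF m]] vm
    by (intro exI[of _ g]) (auto simp: wheel_def cycle_def)
qed
qed

section \<open>Circulant graphs and the extremal host\<close>

lemma ex_connection_set:
  assumes q: "q < s" "even (q * s)"
  shows "\<exists>D. D \<subseteq> {1..<s} \<and> card D = q \<and> (\<forall>d\<in>D. s - d \<in> D)"
proof (cases "even q")
  case True
  then obtain t where t: "q = 2 * t" by auto
  have "card ({1..t} \<union> {s - t..<s}) = card {1..t} + card {s - t..<s}"
    using q t by (intro card_Un_disjoint) auto
  then show ?thesis using q t by (intro exI[of _ "{1..t} \<union> {s - t..<s}"]) auto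
next
  case False
  \<comment> \<open>An odd size needs the fixed point \<open>u\<close> of \<open>d\<close> to
    \<open>s - d\<close>, available because \<open>s\<close> is even.\<close>
  then obtain t u where t: "q = 2 * t + 1" and u: "s = 2 * u" using q(2) by (auto elim!: oddE evenE)
  then show ?thesis using q by (intro exI[of _ "{u - t..u + t}"]) auto
qed

locale lower_host =
  fixes n k s :: nat and D :: "nat set"
  assumes k3: "3 \<le> k" and ks: "k \<le> s" and sn: "s < n" and s2k: "s < 2 * k"
    and D: "D \<subseteq> {1..<s}" "card D = k - 1" "\<And>d. d \<in> D \<Longrightarrow> s - d \<in> D"
begin

text \<open>An independent set of size \<open>n\<close> joined to the disjoint union of \<open>K\<^sub>k\<close> and a
  \<open>(k - 1)\<close>-regular circulant graph on \<open>s\<close> vertices.\<close>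

definition H :: "nat \<Rightarrow> nat \<Rightarrow> bool" where
  "H x y \<longleftrightarrow> x \<noteq> y \<and> (x < n \<and> n \<le> y \<or> y < n \<and> n \<le> x
     \<or> n \<le> x \<and> x < n + k \<and> n \<le> y \<and> y < n + k
     \<or> n + k \<le> x \<and> n + k \<le> y \<and> (if x < y then y - x else x - y) \<in> D)"

text \<open>The bijection \<open>f\<close> is the forward distance from \<open>z\<close> modulo
  \<open>s\<close>; backward distances turn into forward ones since \<open>D\<close> is closed under
  \<open>d\<close> to \<open>s - d\<close>.\<close>

lemma circulant_degree:
  assumes z: "n + k \<le> z" "z < n + k + s"
  shows "card {y \<in> {n + k..<n + k + s}. H z y} = k - 1"
proof -
  define f where "f y = (if z < y then y - z else y + s - z)" for y
  have "bij_betw f {y \<in> {n + k..<n + k + s}. H z y} D"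
  proof (rule bij_betw_byWitness[where f' = "\<lambda>d. if z + d < n + k + s then z + d else z + d - s"])
    show "\<forall>y\<in>{y \<in> {n + k..<n + k + s}. H z y}.
        (if z + f y < n + k + s then z + f y else z + f y - s) = y"
      using z by (auto simp: f_def H_def)
    show "\<forall>d\<in>D. f (if z + d < n + k + s then z + d else z + d - s) = d"
      using z D(1) by (fastforce simp: f_def)
    show "f ` {y \<in> {n + k..<n + k + s}. H z y} \<subseteq> D"
    proof
      fix d assume "d \<in> f ` {y \<in> {n + k..<n + k + s}. H z y}"
      then obtain y where y: "n + k \<le> y" "y < n + k + s" "H z y" "d = f y" by auto
      show "d \<in> D"
      proof (cases "z < y")
        case False
        then have "z - y \<in> D" using y z by (auto simp: H_def)
        moreover have "f y = s - (z - y)" using False y z by (auto simp: f_def)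
        ultimately show ?thesis using D(3) y by simp
      qed (use y z in \<open>auto simp: H_def f_def\<close>)
    qed
    show "(\<lambda>d. if z + d < n + k + s then z + d else z + d - s) ` D \<subseteq> {y \<in> {n + k..<n + k + s}. H z y}"
    proof
      fix y assume "y \<in> (\<lambda>d. if z + d < n + k + s then z + d else z + d - s) ` D"
      then obtain d where d: "d \<in> D" "y = (if z + d < n + k + s then z + d else z + d - s)" by blast
      have "1 \<le> d" "d < s" using d(1) D(1) by auto
      then show "y \<in> {y \<in> {n + k..<n + k + s}. H z y}"
        using d z D(3)[OF d(1)] by (auto simp: H_def)
    qed
  qed
  then show ?thesis using D(2) bij_betw_same_card by metis
qed

text \<open>\<open>H\<close> is the graph to avoid wheels, so the host is its complement. The order
  \<open>r\<close> is a parameter because leastness requires a counterexample for every smaller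
  order; initial segments provide them.\<close>

definition host :: "nat \<Rightarrow> nat graph" where
  "host r = \<lparr>verts = {..<r}, edges = {e \<in> nsets {..<r} 2. \<forall>x y. e = {x, y} \<longrightarrow> \<not> H x y}\<rparr>"

lemma H_sym: "H x y \<longleftrightarrow> H y x"
  by (auto simp: H_def)

lemma simple_host: "simple_graph (host r)"
  by (auto simp: simple_graph_def host_def)

lemma adj_host: "adj (host r) x y \<longleftrightarrow> x < r \<and> y < r \<and> x \<noteq> y \<and> \<not> H x y"
  using H_sym by (auto simp: adj_def host_def doubleton_nsets_2 doubleton_eq_iff)

lemma adj_complement_host: "adj (complement (host r)) x y \<longleftrightarrow> x < r \<and> y < r \<and> H x y"
  by (auto simp: adj_complement adj_host) (auto simp: host_def H_def)

lemma no_star: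
  assumes "r \<le> n + k + s"
  shows "\<not> contains_copy (host r) (star n)"
proof
  assume "contains_copy (host r) (star n)"
  then obtain z where z: "z < r" and c: "n \<le> card (nbs (adj (host r)) {..<r} z)"
    unfolding contains_star[OF simple_host] by (auto simp: host_def)
  define M where "M = {y. y < n + k + s \<and> y \<noteq> z \<and> \<not> H z y}"
  have "nbs (adj (host r)) {..<r} z \<subseteq> M" using assms by (auto simp: adj_host M_def)
  then have cM: "n \<le> card M" using c card_mono[of M "nbs (adj (host r)) {..<r} z"] by (auto simp: M_def)
  consider "z < n" | "n \<le> z" "z < n + k" | "n + k \<le> z" by linarith
  then show False
  proof cases
    case 1
    then have "M \<subseteq> {..<n} - {z}" by (auto simp: M_def H_def)
    then have "card M \<le> card ({..<n} - {z})" by (intro card_mono) auto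
    then show False using cM 1 by simp
  next
    case 2
    then have "M \<subseteq> {n + k..<n + k + s}" by (auto simp: M_def H_def)
    then have "card M \<le> card {n + k..<n + k + s}" by (intro card_mono) auto
    then show False using cM sn by simp
  next
    case 3
    define Q where "Q = {y \<in> {n + k..<n + k + s}. H z y}"
    have zs: "z < n + k + s" using z assms by simp
    have cQ: "card Q = k - 1" unfolding Q_def by (rule circulant_degree[OF 3 zs])
    have fQ: "finite Q" "z \<notin> Q" by (auto simp: Q_def H_def)
    \<comment> \<open>\<open>z\<close> misses the \<open>k\<close> vertices of the clique and
      \<open>s - k\<close> of the circulant part, together \<open>s < n\<close>.\<close>
    have "M \<subseteq> {n..<n + k} \<union> ({n + k..<n + k + s} - insert z Q)"
      using 3 by (auto simp: M_def H_def Q_def)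
    then have "card M \<le> card ({n..<n + k} \<union> ({n + k..<n + k + s} - insert z Q))"
      by (intro card_mono) auto
    also have "\<dots> \<le> card {n..<n + k} + card ({n + k..<n + k + s} - insert z Q)" by (rule card_Un_le)
    also have "card ({n + k..<n + k + s} - insert z Q) = s - card (insert z Q)"
      using 3 zs fQ by (subst card_Diff_subset) (auto simp: Q_def)
    also have "card (insert z Q) = k" using fQ cQ k3 by simp
    finally show False using cM sn ks by simp
  qed
qed

text \<open>Around a hub in the independent set, the rim stays in the clique or in the circulant
  part, both smaller than \<open>2 * k\<close>. Any other hub has at most \<open>k - 1\<close>
  neighbours outside the independent set, but at least half of the rim is outside, as no two
  consecutive rim vertices are independent.\<close>

lemma no_wheel:
  assumes "r \<le> n + k + s"
  shows "\<not> contains_copy (complement (host r)) (wheel (2 * k))"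
proof
  have k6: "3 \<le> 2 * k" using k3 by simp
  let ?E = "adj (complement (host r))"
  have vs: "verts (complement (host r)) = {..<r}" by (simp add: complement_def host_def)
  assume "contains_copy (complement (host r)) (wheel (2 * k))"
  then obtain z cs where z: "z < r" and cs: "cyc ?E (nbs ?E {..<r} z) cs" and len: "length cs = 2 * k"
    unfolding contains_wheel[OF simple_graph_complement[OF simple_host] k6] vs by auto
  have d: "distinct cs" "set cs \<subseteq> nbs ?E {..<r} z" "successively ?E cs"
    using cs by (auto simp: cyc_def pth_def)
  have inH: "y < r \<and> H z y" if "y \<in> set cs" for y using d(2) that by (auto simp: adj_complement_host)
  have step: "H (cs ! i) (cs ! ((i + 1) mod (2 * k)))" if "i < 2 * k" for i
    using cyc_nth_Suc[OF cs, of i] that len by (simp add: adj_complement_host)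
  have card_cs: "card (set cs) = 2 * k" using d(1) len distinct_card by metis
  show False
  proof (cases "z < n")
    case True
    then have ge: "n \<le> y" if "y \<in> set cs" for y using inH[OF that] by (auto simp: H_def)
    have same: "(cs ! i < n + k) = (cs ! 0 < n + k)" if "i < 2 * k" for i
      using that
    proof (induction i)
      case (Suc i)
      have "H (cs ! i) (cs ! Suc i)" using step[of i] Suc.prems by simp
      moreover have "n \<le> cs ! i" "n \<le> cs ! Suc i" using ge Suc.prems len by auto
      ultimately have "(cs ! Suc i < n + k) = (cs ! i < n + k)" by (auto simp: H_def)
      then show ?case using Suc by simp
    qed simp
    show False
    proof (cases "cs ! 0 < n + k")
      case True
      then have "set cs \<subseteq> {n..<n + k}" using same ge len by (fastforce simp: in_set_conv_nth)
      then have "card (set cs) \<le> card {n..<n + k}" by (intro card_mono) auto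
      then show False using card_cs k3 by simp
    next
      case False
      have "y \<in> {n + k..<n + k + s}" if y: "y \<in> set cs" for y
      proof -
        obtain i where "i < 2 * k" "y = cs ! i" using y len by (metis in_set_conv_nth)
        then show ?thesis using same[of i] False inH[OF y] assms by simp
      qed
      then have "set cs \<subseteq> {n + k..<n + k + s}" by blast
      then have "card (set cs) \<le> card {n + k..<n + k + s}" by (intro card_mono) auto
      then show False using card_cs s2k by simp
    qed
  next
    case False
    define P where "P = {y. n \<le> y \<and> y < n + k + s \<and> H z y}"
    have cP: "card P \<le> k - 1"
    proof (cases "z < n + k")
      case True
      then have "P \<subseteq> {n..<n + k} - {z}" using False by (auto simp: P_def H_def)
      then have "card P \<le> card ({n..<n + k} - {z})" by (intro card_mono) auto
      then show ?thesis using True False by simp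
    next
      case nk: False
      then have "P = {y \<in> {n + k..<n + k + s}. H z y}" using False by (auto simp: P_def H_def)
      then show ?thesis using circulant_degree[of z] nk z assms by simp
    qed
    define I J where "I = {i. i < 2 * k \<and> cs ! i < n}" and "J = {i. i < 2 * k \<and> n \<le> cs ! i}"
    have "inj_on (\<lambda>i. cs ! i) J" using d(1) len by (auto simp: inj_on_def J_def nth_eq_iff_index_eq)
    moreover have "(\<lambda>i. cs ! i) ` J \<subseteq> P"
    proof
      fix y assume "y \<in> (\<lambda>i. cs ! i) ` J"
      then have "y \<in> set cs" "n \<le> y" using len by (auto simp: J_def)
      then show "y \<in> P" using inH[of y] assms by (auto simp: P_def)
    qed
    moreover have "finite P" by (simp add: P_def)
    ultimately have cJ: "card J \<le> k - 1" using cP by (metis card_inj_on_le le_trans)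
    have "inj_on (\<lambda>i. (i + 1) mod (2 * k)) I"
      by (auto simp: inj_on_def I_def mod_Suc split: if_splits)
    moreover have "(\<lambda>i. (i + 1) mod (2 * k)) ` I \<subseteq> J"
    proof
      fix j assume "j \<in> (\<lambda>i. (i + 1) mod (2 * k)) ` I"
      then obtain i where "i < 2 * k" "cs ! i < n" "j = (i + 1) mod (2 * k)" by (auto simp: I_def)
      then show "j \<in> J" using step[of i] k3 by (auto simp: H_def J_def)
    qed
    moreover have "finite J" by (simp add: J_def)
    ultimately have "card I \<le> card J" by (rule card_inj_on_le)
    moreover have "I \<union> J = {..<2 * k}" "I \<inter> J = {}" by (auto simp: I_def J_def)
    then have "card I + card J = 2 * k"
      using card_Un_disjoint[of I J] by (simp add: I_def J_def)
    ultimately show False using cJ k3 by simp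
  qed
qed

end

section \<open>Both bounds in terms of graphs, and the Ramsey number\<close>

lemma ramsey_lower:
  assumes "3 \<le> k" "k \<le> s" "s < n" "s < 2 * k" "even ((k - 1) * s)" "r \<le> n + k + s"
  shows "\<exists>G :: nat graph. simple_graph G \<and> card (verts G) = r \<and>
    \<not> contains_copy G (star n) \<and> \<not> contains_copy (complement G) (wheel (2 * k))"
proof -
  have "k - 1 < s" using assms(1,2) by linarith
  then obtain D where "D \<subseteq> {1..<s}" "card D = k - 1" "\<forall>d\<in>D. s - d \<in> D"
    using ex_connection_set assms(5) by blast
  then interpret lower_host n k s D by unfold_locales (use assms in auto)
  have "card (verts (host r)) = r" by (simp add: host_def)
  then show ?thesis using simple_host no_star[OF assms(6)] no_wheel[OF assms(6)] by blast
qed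

lemma ramsey_upper:
  fixes G :: "'a graph"
  assumes G: "simple_graph G" and k3: "3 \<le> k" and kn: "k + 1 \<le> n" "n + 2 \<le> 2 * k"
    and cV: "card (verts G) = 2 * n + k \<or> card (verts G) + 1 = 2 * n + k \<and> even n \<and> even k"
  shows "contains_copy G (star n) \<or> contains_copy (complement G) (wheel (2 * k))"
proof (rule ccontr)
  assume no: "\<not> ?thesis"
  define V E where "V = verts G" and "E = adj (complement G)"
  have finV: "finite V" using G by (simp add: V_def simple_graph_def)
  have vc: "verts (complement G) = V" by (simp add: complement_def V_def)
  interpret sgraph E unfolding E_def by (intro adj_sgraph simple_graph_complement G)
  have miss: "card (V - {x} - nbs E V x) < n" if "x \<in> V" for x
  proof -
    have "card (nbs (adj G) V x) < n"
      using no that unfolding contains_star[OF G] V_def by auto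
    moreover have "V - {x} - nbs E V x \<subseteq> nbs (adj G) V x"
      using that by (auto simp: E_def V_def adj_complement)
    then have "card (V - {x} - nbs E V x) \<le> card (nbs (adj G) V x)" using finV by (intro card_mono) auto
    ultimately show ?thesis by simp
  qed
  have free: "length cs \<noteq> 2 * k" if "z \<in> V" "cyc E (nbs E V z) cs" for z cs
    using no that k3 unfolding contains_wheel[OF simple_graph_complement[OF G], of "2 * k"] vc E_def
    by (metis contains_wheel[OF simple_graph_complement[OF G], of "2 * k"] vc mult_2 trans_le_add1)
  have deg: "card V \<le> card (nbs E V x) + n" if "x \<in> V" for x
  proof -
    have "nbs E V x \<subseteq> V - {x}" using irr by auto
    then have "card (V - {x} - nbs E V x) = card (V - {x}) - card (nbs E V x)"
      using finV by (intro card_Diff_subset) auto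
    then show ?thesis using miss[OF that] that finV by simp
  qed
  \<comment> \<open>All degrees are at least \<open>card V - n\<close>. In the smaller case this is
    \<open>n + k - 1\<close>, an odd number, and equality everywhere would contradict the odd
    order.\<close>
  have "\<exists>v\<in>V. n + k \<le> card (nbs E V v)"
  proof (cases "card V = 2 * n + k")
    case True
    then have "V \<noteq> {}" using k3 by auto
    then show ?thesis using deg True by fastforce
  next
    case False
    then have par: "card V + 1 = 2 * n + k" "even n" "even k" using cV by (auto simp: V_def)
    show ?thesis
    proof (rule ccontr)
      assume "\<not> ?thesis"
      then have "card (nbs E V x) = n + k - 1" if "x \<in> V" for x
        using deg[OF that] that par(1) by fastforce
      moreover have "odd (n + k - 1)" using par(2,3) k3 by simp
      ultimately have "even (card V)" by (rule even_card_of_regular[OF finV])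
      then have "odd (card V + 1)" by simp
      then show False unfolding par(1) using par(3) by simp
    qed
  qed
  then obtain v U where v: "v \<in> V" "U \<subseteq> nbs E V v" "card U = n + k"
    by (metis obtain_subset_with_card_n)
  interpret wheel_free E V U v n k
    by unfold_locales (use finV k3 kn miss v cV free in \<open>auto simp: V_def\<close>)
  show False by (rule contradiction)
qed

theorem theorem4:
  fixes n m :: nat
  assumes "even m" and "n + 2 \<le> m" and "m \<le> 2 * n - 2"
  shows "ramsey_number (star n) (wheel m) =
    (if even n \<and> even (m div 2) then 2 * n + m div 2 - 1 else 2 * n + m div 2)"
proof -
  obtain k where m: "m = 2 * k" using assms(1) by auto
  then have k: "3 \<le> k" "k + 1 \<le> n" "n + 2 \<le> 2 * k" using assms(2,3) by auto
  define b :: nat where "b = (if even n \<and> even k then 1 else 0)"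
  \<comment> \<open>Needed for \<open>k \<le> s\<close> when \<open>s = n - 2\<close>.\<close>
  have nk2: "n \<noteq> k + 1" if "b = 1" using that by (auto simp: b_def split: if_splits)
  have par: "b = 0 \<Longrightarrow> odd n \<or> odd k" "b = 1 \<Longrightarrow> even n \<and> even k" "b = 0 \<or> b = 1"
    by (auto simp: b_def split: if_splits)
  have "ramsey_number (star n) (wheel (2 * k)) = 2 * n + k - b"
    unfolding ramsey_number_def
  proof (rule Least_equality)
    show "\<forall>G :: nat graph. simple_graph G \<and> card (verts G) = 2 * n + k - b \<longrightarrow>
       contains_copy G (star n) \<or> contains_copy (complement G) (wheel (2 * k))"
    proof (intro allI impI)
      fix G :: "nat graph"
      assume G: "simple_graph G \<and> card (verts G) = 2 * n + k - b"
      then have "card (verts G) = 2 * n + k \<or> card (verts G) + 1 = 2 * n + k \<and> even n \<and> even k"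
        using par k by auto
      then show "contains_copy G (star n) \<or> contains_copy (complement G) (wheel (2 * k))"
        using ramsey_upper G k by blast
    qed
  next
    fix r
    assume r: "\<forall>G :: nat graph. simple_graph G \<and> card (verts G) = r \<longrightarrow>
       contains_copy G (star n) \<or> contains_copy (complement G) (wheel (2 * k))"
    show "2 * n + k - b \<le> r"
    proof (rule ccontr)
      assume "\<not> 2 * n + k - b \<le> r"
      \<comment> \<open>The choice makes \<open>n + k + s\<close> one less than the claimed number.
        For \<open>b = 0\<close> the product \<open>(k - 1) * (n - 1)\<close> is even, for
        \<open>b = 1\<close> the number \<open>n - 2\<close> is.\<close>
      define s where "s = n - 1 - b"
      have "k \<le> s" "s < n" "s < 2 * k" "r \<le> n + k + s"
        using k par(3) nk2 \<open>\<not> 2 * n + k - b \<le> r\<close> by (auto simp: s_def)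
      moreover have "even ((k - 1) * s)" using par k by (auto simp: s_def)
      ultimately show False using ramsey_lower[OF k(1)] r by blast
    qed
  qed
  moreover have "m div 2 = k" using m by simp
  ultimately show ?thesis using m by (auto simp: b_def)
qed

end
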